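(* (1) Let $\Omega=\{(x_1,x_2)\in\mathbb{R}^2:x_2<0\}$, regarded as a convex domain in $\ell^\infty(2)=(\mathbb{R}^2,\|\cdot\|_\infty)$, and let $x=(0,-1)$, $a=(-1,-2)$, $b=(1,-2)$. Then $a,b\in\mathbf{B}_k(x,\log 2)$, but no quasihyperbolic geodesic of $\Omega$ joining $a$ and $b$ is contained in $\mathbf{B}_k(x,\log 2)$; in particular this quasihyperbolic ball is not quasihyperbolically convex. (2) There exist a uniformly convex Banach space $X$ (which can be taken to be $\ell^p(2)=(\mathbb{R}^2,\|\cdot\|_p)$ for some large $p<\infty$), a convex domain $\Omega\subsetneq X$, and a quasihyperbolic ball of $\Omega$ which is not quasihyperbolically convex.
   Context: Let $X$ be a Banach space and $\Omega\subsetneq X$ a domain (nonempty open connected set). For $x\in\Omega$ write $d(x)=d(x,\partial\Omega)$ for the norm distance to the boundary. For a rectifiable path $\gamma:[0,1]\to\Omega$, its quasihyperbolic length is $\ell_k(\gamma)=\int_{[0,1]}\frac{\|d\gamma\|}{d(\gamma(t))}$, where $\|d\gamma\|$ denotes integration with respect to the norm arc length of $\gamma$; the quasihyperbolic distance is $k(x,y)=\inf_\gamma\ell_k(\gamma)$ over all rectifiable paths $\gamma$ joining $x$ and $y$ in $\Omega$. The quasihyperbolic ball is $\mathbf{B}_k(x,r)=\{y\in\Omega:k(x,y)\le r\}$. A quasihyperbolic geodesic joining $a,b\in\Omega$ is a path $\gamma$ in $\Omega$ from $a$ to $b$ with $\ell_k(\gamma)=k(a,b)$. A quasihyperbolic ball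 $B\subset\Omega$ is quasihyperbolically convex if for any $a,b\in B$ there exists a quasihyperbolic geodesic joining $a$ and $b$ which is contained in $B$. $X$ is uniformly convex if for every $0<\epsilon\le 2$, $\inf\{1-\|x+y\|/2:\|x\|=\|y\|=1,\ \|x-y\|=\epsilon\}>0$. *)

theory Defs
  imports "HOL-Analysis.Analysis"
begin

text \<open>
  The norm is an explicit function \<open>N\<close> on a real vector space rather than the norm of a type class,
  since the statement concerns the norms \<open>\<ell>\<^sup>p\<close>, with \<open>p\<close> a real variable, and \<open>\<ell>\<^sup>\<infinity>\<close> on the same plane.
  All topological notions below refer to the metric \<open>N (x - y)\<close>, via the library's
  \<^locale>\<open>Metric_space\<close>.
\<close>

definition is_norm :: "('a::real_vector \<Rightarrow> real) \<Rightarrow> bool" where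
  "is_norm N \<longleftrightarrow>
     (\<forall>x. 0 \<le> N x) \<and> (\<forall>x. N x = 0 \<longleftrightarrow> x = 0) \<and>
     (\<forall>c x. N (c *\<^sub>R x) = \<bar>c\<bar> * N x) \<and> (\<forall>x y. N (x + y) \<le> N x + N y)"

definition norm_topology :: "('a::real_vector \<Rightarrow> real) \<Rightarrow> 'a topology" where
  "norm_topology N = Metric_space.mtopology UNIV (\<lambda>x y. N (x - y))"

definition banach_norm :: "('a::real_vector \<Rightarrow> real) \<Rightarrow> bool" where
  "banach_norm N \<longleftrightarrow> is_norm N \<and> Metric_space.mcomplete UNIV (\<lambda>x y. N (x - y))"

text \<open>
  The infimum is taken in \<^typ>\<open>ereal\<close>, so that it is \<open>\<infinity>\<close> when no such pair \<open>x, y\<close> exists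
  (which happens only in dimension at most one).
\<close>

definition uniformly_convex :: "('a::real_vector \<Rightarrow> real) \<Rightarrow> bool" where
  "uniformly_convex N \<longleftrightarrow>
     (\<forall>\<epsilon>. 0 < \<epsilon> \<and> \<epsilon> \<le> 2 \<longrightarrow>
        0 < (INF (x, y) \<in> {(x, y). N x = 1 \<and> N y = 1 \<and> N (x - y) = \<epsilon>}.
               ereal (1 - N (x + y) / 2)))"

definition proper_domain :: "('a::real_vector \<Rightarrow> real) \<Rightarrow> 'a set \<Rightarrow> bool" where
  "proper_domain N \<Omega> \<longleftrightarrow>
     \<Omega> \<noteq> {} \<and> \<Omega> \<noteq> UNIV \<and> openin (norm_topology N) \<Omega> \<and> connectedin (norm_topology N) \<Omega>"

definition bdist :: "('a::real_vector \<Rightarrow> real) \<Rightarrow> 'a set \<Rightarrow> 'a \<Rightarrow> real" where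
  "bdist N \<Omega> x = (INF z \<in> norm_topology N frontier_of \<Omega>. N (x - z))"

definition variation_sums ::
    "('a::real_vector \<Rightarrow> real) \<Rightarrow> (real \<Rightarrow> 'a) \<Rightarrow> real \<Rightarrow> real \<Rightarrow> real set" where
  "variation_sums N \<gamma> s t =
     {(\<Sum>i<n. N (\<gamma> (\<tau> (Suc i)) - \<gamma> (\<tau> i))) | n \<tau>.
        mono_on {..n::nat} \<tau> \<and> \<tau> 0 = s \<and> \<tau> n = t}"

definition arc_length ::
    "('a::real_vector \<Rightarrow> real) \<Rightarrow> (real \<Rightarrow> 'a) \<Rightarrow> real \<Rightarrow> real \<Rightarrow> real" where
  "arc_length N \<gamma> s t = Sup (variation_sums N \<gamma> s t)"

definition rectifiable_path_in ::
    "('a::real_vector \<Rightarrow> real) \<Rightarrow> 'a set \<Rightarrow> 'a \<Rightarrow> 'a \<Rightarrow> (real \<Rightarrow> 'a) \<Rightarrow> bool" where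
  "rectifiable_path_in N \<Omega> x y \<gamma> \<longleftrightarrow>
     pathin (norm_topology N) \<gamma> \<and> \<gamma> ` {0..1} \<subseteq> \<Omega> \<and> \<gamma> 0 = x \<and> \<gamma> 1 = y \<and>
     bdd_above (variation_sums N \<gamma> 0 1)"

text \<open>
  Integration with respect to arc length is integration against the Lebesgue--Stieltjes measure
  of the arc length function of \<open>\<gamma>\<close>, extended to be constant outside \<open>[0,1]\<close>.
\<close>

definition arc_measure ::
    "('a::real_vector \<Rightarrow> real) \<Rightarrow> (real \<Rightarrow> 'a) \<Rightarrow> real measure" where
  "arc_measure N \<gamma> = interval_measure (\<lambda>t. arc_length N \<gamma> 0 (max 0 (min 1 t)))"

definition qh_length ::
    "('a::real_vector \<Rightarrow> real) \<Rightarrow> 'a set \<Rightarrow> (real \<Rightarrow> 'a) \<Rightarrow> real" where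
  "qh_length N \<Omega> \<gamma> = (LINT t:{0..1}|arc_measure N \<gamma>. 1 / bdist N \<Omega> (\<gamma> t))"

definition qh_dist ::
    "('a::real_vector \<Rightarrow> real) \<Rightarrow> 'a set \<Rightarrow> 'a \<Rightarrow> 'a \<Rightarrow> real" where
  "qh_dist N \<Omega> x y = (INF \<gamma> \<in> {\<gamma>. rectifiable_path_in N \<Omega> x y \<gamma>}. qh_length N \<Omega> \<gamma>)"

definition qh_ball ::
    "('a::real_vector \<Rightarrow> real) \<Rightarrow> 'a set \<Rightarrow> 'a \<Rightarrow> real \<Rightarrow> 'a set" where
  "qh_ball N \<Omega> x r = {y \<in> \<Omega>. qh_dist N \<Omega> x y \<le> r}"

definition qh_geodesic ::
    "('a::real_vector \<Rightarrow> real) \<Rightarrow> 'a set \<Rightarrow> 'a \<Rightarrow> 'a \<Rightarrow> (real \<Rightarrow> 'a) \<Rightarrow> bool" where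
  "qh_geodesic N \<Omega> a b \<gamma> \<longleftrightarrow>
     rectifiable_path_in N \<Omega> a b \<gamma> \<and> qh_length N \<Omega> \<gamma> = qh_dist N \<Omega> a b"

definition qh_convex :: "('a::real_vector \<Rightarrow> real) \<Rightarrow> 'a set \<Rightarrow> 'a set \<Rightarrow> bool" where
  "qh_convex N \<Omega> B \<longleftrightarrow>
     (\<forall>a\<in>B. \<forall>b\<in>B. \<exists>\<gamma>. qh_geodesic N \<Omega> a b \<gamma> \<and> \<gamma> ` {0..1} \<subseteq> B)"

text \<open>The norm of \<open>\<ell>\<^sup>\<infinity>(2)\<close> is the library's \<^const>\<open>infnorm\<close>.\<close>

definition lp_norm :: "real \<Rightarrow> real ^ 'n::finite \<Rightarrow> real" where
  "lp_norm p x = (\<Sum>i\<in>UNIV. \<bar>x $ i\<bar> powr p) powr (1 / p)"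

definition lower_half_plane :: "(real ^ 2) set" where
  "lower_half_plane = {x. x $ 2 < 0}"

end

theory Submission
  imports Defs
begin

text \<open>
  For a norm on the plane that dominates both coordinates, has \<open>\<parallel>(0, 1)\<parallel> = 1\<close> and gives both
  diagonals \<open>(1, 1)\<close> and \<open>(1, -1)\<close> the length \<open>c\<close>, the distance to the boundary of the lower
  half-plane is the height \<open>- x\<^sub>2\<close>. The diagonal segments show that \<open>a\<close> and \<open>b\<close> have quasihyperbolic
  distance at most \<open>c ln 2\<close> from \<open>x\<close>. A path covering the heights from \<open>s\<close> to \<open>t\<close> has quasihyperbolic
  length at least \<open>\<bar>ln t - ln s\<bar>\<close>, so the ball of radius \<open>c ln 2\<close> about \<open>x\<close> stays below
  height \<open>2\<^sup>c\<close>, and a path from \<open>a\<close> to \<open>b\<close> inside it has length at least \<open>2 / 2\<^sup>c\<close>. The tent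
  through \<open>(0, -3)\<close> leaves the ball and has length only \<open>c ln (9/4)\<close>, which is smaller as soon as \<open>c\<close>
  is close to \<open>1\<close>: for \<open>\<ell>\<^sup>\<infinity>\<close> one has \<open>c = 1\<close>, for \<open>\<ell>\<^sup>p\<close> one has \<open>c = 2\<^bsup>1/p\<^esup>\<close>.
\<close>

subsection \<open>Norms on Euclidean spaces\<close>

lemma is_norm_nonneg: "is_norm N \<Longrightarrow> 0 \<le> N x"
  and is_norm_eq_0: "is_norm N \<Longrightarrow> N x = 0 \<longleftrightarrow> x = 0"
  and is_norm_scaleR: "is_norm N \<Longrightarrow> N (c *\<^sub>R x) = \<bar>c\<bar> * N x"
  and is_norm_triangle: "is_norm N \<Longrightarrow> N (x + y) \<le> N x + N y"
  by (auto simp: is_norm_def)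

lemma is_norm_minus: "is_norm N \<Longrightarrow> N (- x) = N x"
  using is_norm_scaleR[of N "-1" x] by simp

lemma is_norm_minus_commute: "is_norm N \<Longrightarrow> N (x - y) = N (y - x)"
  using is_norm_minus[of N "x - y"] by simp

lemma is_norm_triangle_mid: "is_norm N \<Longrightarrow> N (x - z) \<le> N (x - y) + N (y - z)"
  using is_norm_triangle[of N "x - y" "y - z"] by simp

lemma is_norm_sum:
  assumes "is_norm N" "finite A"
  shows "N (\<Sum>i\<in>A. f i) \<le> (\<Sum>i\<in>A. N (f i))"
  using assms(2)
proof (induction A rule: finite_induct)
  case empty
  then show ?case using is_norm_eq_0[OF assms(1), of 0] by simp
next
  case (insert i A)
  then show ?case
    using is_norm_triangle[OF assms(1), of "f i" "\<Sum>i\<in>A. f i"] by simp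
qed

text \<open>Expansion in the standard basis bounds \<open>N x\<close> by the values of
  \<open>N\<close> on the basis. The summand 1 in the constant makes its positivity
  immediate.\<close>

lemma is_norm_le_norm:
  fixes N :: "'a::euclidean_space \<Rightarrow> real"
  assumes "is_norm N"
  obtains C where "C > 0" "\<And>x. N x \<le> C * norm x"
proof
  let ?C = "1 + (\<Sum>b\<in>Basis. N b)"
  have nonneg: "0 \<le> (\<Sum>b\<in>Basis. N b)"
    by (intro sum_nonneg is_norm_nonneg assms)
  then show "?C > 0" by simp
  show "N x \<le> ?C * norm x" for x
  proof -
    have "N x = N (\<Sum>b\<in>Basis. (x \<bullet> b) *\<^sub>R b)"
      by (simp add: euclidean_representation)
    also have "\<dots> \<le> (\<Sum>b\<in>Basis. N ((x \<bullet> b) *\<^sub>R b))"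
      by (intro is_norm_sum assms finite_Basis)
    also have "\<dots> \<le> (\<Sum>b\<in>Basis. norm x * N b)"
      by (intro sum_mono)
        (simp add: is_norm_scaleR[OF assms] mult_right_mono is_norm_nonneg[OF assms] Basis_le_norm)
    also have "\<dots> \<le> ?C * norm x"
      using nonneg by (simp add: sum_distrib_left algebra_simps)
    finally show ?thesis .
  qed
qed

lemma continuous_on_is_norm:
  fixes N :: "'a::euclidean_space \<Rightarrow> real"
  assumes "is_norm N"
  shows "continuous_on A N"
proof -
  obtain C where C: "C > 0" "\<And>x. N x \<le> C * norm x"
    by (rule is_norm_le_norm[OF assms]) blast
  have "C-lipschitz_on A N"
  proof (rule lipschitz_onI)
    show "dist (N x) (N y) \<le> C * dist x y" for x y
      using is_norm_triangle[OF assms, of "x - y" y] is_norm_triangle[OF assms, of "y - x" x]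
        C(2)[of "x - y"] is_norm_minus_commute[OF assms, of x y]
      by (simp add: dist_norm)
  qed (use C in simp)
  then show ?thesis
    by (rule lipschitz_on_continuous_on)
qed

lemmas continuous_on_is_norm_comp = continuous_on_compose2[OF continuous_on_is_norm _ subset_UNIV]

text \<open>The constant is the minimum of \<open>N\<close> on the Euclidean unit sphere, which is
  attained by compactness and positive because the minimizer is nonzero.\<close>

lemma is_norm_ge_norm:
  fixes N :: "'a::euclidean_space \<Rightarrow> real"
  assumes "is_norm N"
  obtains c where "c > 0" "\<And>x. c * norm x \<le> N x"
proof -
  have "sphere (0::'a) 1 \<noteq> {}" by simp
  then obtain m where m: "m \<in> sphere (0::'a) 1" "\<And>x. x \<in> sphere 0 1 \<Longrightarrow> N m \<le> N x"
    using continuous_attains_inf[OF compact_sphere _ continuous_on_is_norm[OF assms]] by blast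
  show thesis
  proof
    have "m \<noteq> 0" using m(1) by auto
    then show "N m > 0"
      using is_norm_nonneg[OF assms, of m] is_norm_eq_0[OF assms, of m] by linarith
    show "N m * norm x \<le> N x" for x
    proof (cases "x = 0")
      case False
      then have "N m \<le> N (sgn x)"
        by (intro m(2)) (simp add: norm_sgn)
      also have "\<dots> = N x / norm x"
        by (simp add: sgn_div_norm is_norm_scaleR[OF assms] divide_inverse_commute)
      finally show ?thesis
        using False by (simp add: field_simps)
    qed (use is_norm_nonneg[OF assms] in simp)
  qed
qed

lemma Metric_space_is_norm: "is_norm N \<Longrightarrow> Metric_space UNIV (\<lambda>x y. N (x - y))"
  by unfold_locales
    (simp_all add: is_norm_nonneg is_norm_minus_commute is_norm_eq_0 is_norm_triangle_mid)

text \<open>The two-sided comparison with the Euclidean norm puts a ball of each metric inside every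
  ball of the other. Openness, frontiers and paths for \<open>N\<close> thereby become the Euclidean
  ones.\<close>

lemma norm_topology_eq_euclidean:
  fixes N :: "'a::euclidean_space \<Rightarrow> real"
  assumes "is_norm N"
  shows "norm_topology N = euclidean"
proof -
  interpret Metric_space UNIV "\<lambda>x y. N (x - y)"
    by (rule Metric_space_is_norm[OF assms])
  obtain C where C: "C > 0" "\<And>x. N x \<le> C * norm x"
    by (rule is_norm_le_norm[OF assms]) blast
  obtain c where c: "c > 0" "\<And>x. c * norm x \<le> N x"
    by (rule is_norm_ge_norm[OF assms]) blast
  have 1: "ball x (r / C) \<subseteq> mball x r" for x r
  proof
    fix y assume "y \<in> ball x (r / C)"
    then have "C * norm (x - y) < r"
      using C(1) by (simp add: dist_norm field_simps)
    then show "y \<in> mball x r"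
      using C(2)[of "x - y"] by simp
  qed
  have 2: "mball x (r * c) \<subseteq> ball x r" for x r
  proof
    fix y assume "y \<in> mball x (r * c)"
    then have "c * norm (x - y) < c * r"
      using c(2)[of "x - y"] by (simp add: mult.commute)
    then show "y \<in> ball x r"
      using c(1) by (simp add: dist_norm)
  qed
  have "(\<exists>r>0. mball x r \<subseteq> U) \<longleftrightarrow> (\<exists>r>0. ball x r \<subseteq> U)" for x U
  proof
    assume "\<exists>r>0. mball x r \<subseteq> U"
    then obtain r where "r > 0" "mball x r \<subseteq> U" by blast
    then show "\<exists>r>0. ball x r \<subseteq> U"
      using subset_trans[OF 1[of x r]] C(1) by (intro exI[of _ "r / C"] conjI divide_pos_pos)
  next
    assume "\<exists>r>0. ball x r \<subseteq> U"
    then obtain r where "r > 0" "ball x r \<subseteq> U" by blast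
    then show "\<exists>r>0. mball x r \<subseteq> U"
      using subset_trans[OF 2[of x r]] c(1) by (intro exI[of _ "r * c"] conjI mult_pos_pos)
  qed
  then show ?thesis
    unfolding norm_topology_def topology_eq openin_mtopology open_openin[symmetric] open_contains_ball
    by (simp add: Ball_def)
qed

lemma banach_norm_euclidean:
  fixes N :: "'a::euclidean_space \<Rightarrow> real"
  assumes "is_norm N"
  shows "banach_norm N"
proof -
  interpret Metric_space UNIV "\<lambda>x y. N (x - y)"
    by (rule Metric_space_is_norm[OF assms])
  obtain c where c: "c > 0" "\<And>x. c * norm x \<le> N x"
    by (rule is_norm_ge_norm[OF assms]) blast
  have "\<exists>l. limitin mtopology \<sigma> l sequentially" if \<sigma>: "MCauchy \<sigma>" for \<sigma>
  proof -
    have "Cauchy \<sigma>"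
    proof (rule metric_CauchyI)
      fix e :: real assume "e > 0"
      then have "c * e > 0" using c(1) by simp
      then obtain M where "\<And>n n'. M \<le> n \<Longrightarrow> M \<le> n' \<Longrightarrow> N (\<sigma> n - \<sigma> n') < c * e"
        using \<sigma> unfolding MCauchy_def by blast
      then have "\<And>n n'. M \<le> n \<Longrightarrow> M \<le> n' \<Longrightarrow> c * norm (\<sigma> n - \<sigma> n') < c * e"
        using c(2) le_less_trans by blast
      then show "\<exists>M. \<forall>m\<ge>M. \<forall>n\<ge>M. dist (\<sigma> m) (\<sigma> n) < e"
        using c(1) by (auto simp: dist_norm)
    qed
    then obtain l where "\<sigma> \<longlonglongrightarrow> l"
      using Cauchy_convergent convergent_def by blast
    moreover have "mtopology = euclidean"
      using norm_topology_eq_euclidean[OF assms] unfolding norm_topology_def .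
    ultimately show ?thesis
      by auto
  qed
  then show ?thesis
    unfolding banach_norm_def mcomplete_def using assms by blast
qed

subsection \<open>Arc length\<close>

lemma variation_sumsI:
  "mono_on {..n::nat} \<tau> \<Longrightarrow> \<tau> 0 = s \<Longrightarrow> \<tau> n = t \<Longrightarrow>
    (\<Sum>i<n. N (\<gamma> (\<tau> (Suc i)) - \<gamma> (\<tau> i))) \<in> variation_sums N \<gamma> s t"
  unfolding variation_sums_def by blast

lemma increment_in_variation_sums:
  assumes "s \<le> t"
  shows "N (\<gamma> t - \<gamma> s) \<in> variation_sums N \<gamma> s t"
  using variation_sumsI[of 1 "\<lambda>i. if i = 0 then s else t" s t N \<gamma>] assms
  by (auto simp: mono_on_def)

text \<open>The control function \<open>\<psi>\<close> telescopes along every subdivision. It is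
  linear for Lipschitz paths and a multiple of the height for paths of monotone height.\<close>

lemma variation_sums_le:
  assumes "v \<in> variation_sums N \<gamma> s t"
    and \<psi>: "\<And>u w. s \<le> u \<Longrightarrow> u \<le> w \<Longrightarrow> w \<le> t \<Longrightarrow> N (\<gamma> w - \<gamma> u) \<le> \<psi> w - \<psi> u"
  shows "v \<le> \<psi> t - \<psi> s"
proof -
  obtain n \<tau> where v: "v = (\<Sum>i<n. N (\<gamma> (\<tau> (Suc i)) - \<gamma> (\<tau> i)))"
    and \<tau>: "mono_on {..n::nat} \<tau>" "\<tau> 0 = s" "\<tau> n = t"
    using assms(1) unfolding variation_sums_def by blast
  have "v \<le> (\<Sum>i<n. \<psi> (\<tau> (Suc i)) - \<psi> (\<tau> i))"
    unfolding v
  proof (rule sum_mono)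
    fix i assume "i \<in> {..<n}"
    then have "\<tau> 0 \<le> \<tau> i" "\<tau> i \<le> \<tau> (Suc i)" "\<tau> (Suc i) \<le> \<tau> n"
      by (auto intro!: mono_onD[OF \<tau>(1)])
    then show "N (\<gamma> (\<tau> (Suc i)) - \<gamma> (\<tau> i)) \<le> \<psi> (\<tau> (Suc i)) - \<psi> (\<tau> i)"
      using \<tau> by (intro \<psi>) auto
  qed
  also have "\<dots> = \<psi> t - \<psi> s"
    by (simp add: sum_lessThan_telescope[of "\<lambda>i. \<psi> (\<tau> i)"] \<tau>)
  finally show ?thesis .
qed

lemma variation_sums_concat:
  assumes "v \<in> variation_sums N \<gamma> s t" "w \<in> variation_sums N \<gamma> t u"
  shows "v + w \<in> variation_sums N \<gamma> s u"
proof -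
  obtain n \<tau> where v: "v = (\<Sum>i<n. N (\<gamma> (\<tau> (Suc i)) - \<gamma> (\<tau> i)))"
    and \<tau>: "mono_on {..n::nat} \<tau>" "\<tau> 0 = s" "\<tau> n = t"
    using assms(1) unfolding variation_sums_def by blast
  obtain m \<rho> where w: "w = (\<Sum>i<m. N (\<gamma> (\<rho> (Suc i)) - \<gamma> (\<rho> i)))"
    and \<rho>: "mono_on {..m::nat} \<rho>" "\<rho> 0 = t" "\<rho> m = u"
    using assms(2) unfolding variation_sums_def by blast
  define \<kappa> where "\<kappa> i = (if i \<le> n then \<tau> i else \<rho> (i - n))" for i
  \<comment> \<open>The junction index \<open>n\<close> falls under the first case of
    \<open>\<kappa>\<close>, so \<open>i = 0\<close> relies on
    \<open>\<tau> n = t = \<rho> 0\<close>.\<close>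
  have eq: "\<kappa> (n + i) = \<rho> i" for i
    using \<tau> \<rho> by (cases i) (auto simp: \<kappa>_def)
  have "mono_on {..n + m} \<kappa>"
  proof (rule mono_onI)
    fix i j assume ij: "i \<in> {..n + m}" "j \<in> {..n + m}" "i \<le> j"
    consider "j \<le> n" | "i \<le> n" "n < j" | "n < i" by linarith
    then show "\<kappa> i \<le> \<kappa> j"
    proof cases
      case 1
      then show ?thesis using ij by (auto simp: \<kappa>_def intro!: mono_onD[OF \<tau>(1)])
    next
      case 2
      have "\<tau> i \<le> \<tau> n" using 2 by (intro mono_onD[OF \<tau>(1)]) auto
      also have "\<tau> n = \<rho> 0" using \<tau> \<rho> by simp
      also have "\<dots> \<le> \<rho> (j - n)" using 2 ij by (intro mono_onD[OF \<rho>(1)]) auto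
      finally show ?thesis using 2 by (simp add: \<kappa>_def)
    next
      case 3
      then show ?thesis using ij by (auto simp: \<kappa>_def intro!: mono_onD[OF \<rho>(1)])
    qed
  qed
  moreover have "\<kappa> 0 = s" "\<kappa> (n + m) = u"
    using \<tau> \<rho> eq[of m] by (auto simp: \<kappa>_def)
  ultimately have "(\<Sum>i<n + m. N (\<gamma> (\<kappa> (Suc i)) - \<gamma> (\<kappa> i))) \<in> variation_sums N \<gamma> s u"
    by (rule variation_sumsI)
  also have "(\<Sum>i<n + m. N (\<gamma> (\<kappa> (Suc i)) - \<gamma> (\<kappa> i))) =
      (\<Sum>i<n. N (\<gamma> (\<kappa> (Suc i)) - \<gamma> (\<kappa> i))) + (\<Sum>i<m. N (\<gamma> (\<kappa> (n + Suc i)) - \<gamma> (\<kappa> (n + i))))"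
    by (induction m) auto
  also have "\<dots> = v + w"
    unfolding v w eq by (simp add: \<kappa>_def)
  finally show ?thesis .
qed

text \<open>
  Truncating a subdivision \<open>\<tau>\<close> of \<open>[s, u]\<close> to \<open>min \<tau> t\<close> and \<open>max \<tau> t\<close> splits it at \<open>t\<close>
  without having to locate \<open>t\<close> among its points.
\<close>

lemma increment_le_min_max:
  fixes \<gamma> :: "real \<Rightarrow> 'a::real_vector"
  assumes "is_norm N" "a \<le> b"
  shows "N (\<gamma> b - \<gamma> a) \<le>
    N (\<gamma> (min b t) - \<gamma> (min a t)) + N (\<gamma> (max b t) - \<gamma> (max a t))"
proof -
  consider "b \<le> t" | "t \<le> a" | "a < t" "t < b" by linarith
  then show ?thesis
  proof cases
    case 3
    then show ?thesis
      using is_norm_triangle_mid[OF assms(1), of "\<gamma> b" "\<gamma> a" "\<gamma> t"] by simp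
  qed (use assms is_norm_nonneg in auto)
qed

locale rectifiable =
  fixes N :: "'a::euclidean_space \<Rightarrow> real" and \<gamma> :: "real \<Rightarrow> 'a"
  assumes norm: "is_norm N"
    and cont: "continuous_on {0..1} \<gamma>"
    and bdd: "bdd_above (variation_sums N \<gamma> 0 1)"
begin

text \<open>A variation sum on \<open>[s, t]\<close> extends to one on \<open>[0, 1]\<close> by
  adding the single increments over \<open>[0, s]\<close> and \<open>[t, 1]\<close>, which are
  nonnegative.\<close>

lemma bdd_above_variation_sums:
  assumes "0 \<le> s" "s \<le> t" "t \<le> 1"
  shows "bdd_above (variation_sums N \<gamma> s t)"
proof -
  obtain M where M: "\<And>v. v \<in> variation_sums N \<gamma> 0 1 \<Longrightarrow> v \<le> M"
    using bdd unfolding bdd_above_def by blast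
  show ?thesis
  proof (rule bdd_aboveI)
    fix v assume "v \<in> variation_sums N \<gamma> s t"
    then have "N (\<gamma> s - \<gamma> 0) + v + N (\<gamma> 1 - \<gamma> t) \<in> variation_sums N \<gamma> 0 1"
      using assms by (auto intro!: variation_sums_concat increment_in_variation_sums)
    then show "v \<le> M"
      using M[of "N (\<gamma> s - \<gamma> 0) + v + N (\<gamma> 1 - \<gamma> t)"] is_norm_nonneg[OF norm, of "\<gamma> s - \<gamma> 0"]
        is_norm_nonneg[OF norm, of "\<gamma> 1 - \<gamma> t"] by linarith
  qed
qed

lemma le_arc_length:
  "0 \<le> s \<Longrightarrow> s \<le> t \<Longrightarrow> t \<le> 1 \<Longrightarrow> v \<in> variation_sums N \<gamma> s t \<Longrightarrow> v \<le> arc_length N \<gamma> s t"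
  unfolding arc_length_def by (rule cSup_upper[OF _ bdd_above_variation_sums])

lemma increment_le_arc_length:
  "0 \<le> s \<Longrightarrow> s \<le> t \<Longrightarrow> t \<le> 1 \<Longrightarrow> N (\<gamma> t - \<gamma> s) \<le> arc_length N \<gamma> s t"
  by (intro le_arc_length increment_in_variation_sums)

lemma arc_length_le:
  "s \<le> t \<Longrightarrow> (\<And>v. v \<in> variation_sums N \<gamma> s t \<Longrightarrow> v \<le> M) \<Longrightarrow> arc_length N \<gamma> s t \<le> M"
  unfolding arc_length_def using increment_in_variation_sums[of s t N \<gamma>] by (intro cSup_least) auto

lemma arc_length_nonneg: "0 \<le> s \<Longrightarrow> s \<le> t \<Longrightarrow> t \<le> 1 \<Longrightarrow> 0 \<le> arc_length N \<gamma> s t"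
  using increment_le_arc_length is_norm_nonneg[OF norm] order_trans by blast

text \<open>Only the part after \<open>t\<close> is replaced by an arc length. The truncated sum
  before \<open>t\<close> stays explicit because it has two uses: it is at most the arc length of
  \<open>[s, t]\<close>, giving additivity, and it tends to 0 as \<open>t\<close> decreases to
  \<open>s\<close>, giving right continuity.\<close>

lemma variation_sum_le_min_arc_length:
  assumes \<tau>: "mono_on {..n::nat} \<tau>" "\<tau> 0 = s" "\<tau> n = u"
    and "0 \<le> s" "s \<le> t" "t \<le> u" "u \<le> 1"
  shows "(\<Sum>i<n. N (\<gamma> (\<tau> (Suc i)) - \<gamma> (\<tau> i)))
    \<le> (\<Sum>i<n. N (\<gamma> (min (\<tau> (Suc i)) t) - \<gamma> (min (\<tau> i) t))) + arc_length N \<gamma> t u"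
proof -
  have "(\<Sum>i<n. N (\<gamma> (\<tau> (Suc i)) - \<gamma> (\<tau> i)))
    \<le> (\<Sum>i<n. N (\<gamma> (min (\<tau> (Suc i)) t) - \<gamma> (min (\<tau> i) t))
              + N (\<gamma> (max (\<tau> (Suc i)) t) - \<gamma> (max (\<tau> i) t)))"
    by (intro sum_mono increment_le_min_max norm mono_onD[OF \<tau>(1)]) auto
  also have "\<dots> = (\<Sum>i<n. N (\<gamma> (min (\<tau> (Suc i)) t) - \<gamma> (min (\<tau> i) t)))
              + (\<Sum>i<n. N (\<gamma> (max (\<tau> (Suc i)) t) - \<gamma> (max (\<tau> i) t)))"
    by (rule sum.distrib)
  also have "(\<Sum>i<n. N (\<gamma> (max (\<tau> (Suc i)) t) - \<gamma> (max (\<tau> i) t))) \<le> arc_length N \<gamma> t u"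
  proof (rule le_arc_length)
    have "mono_on {..n} (\<lambda>i. max (\<tau> i) t)"
      by (intro mono_onI max.mono order_refl mono_onD[OF \<tau>(1)])
    then show "(\<Sum>i<n. N (\<gamma> (max (\<tau> (Suc i)) t) - \<gamma> (max (\<tau> i) t))) \<in> variation_sums N \<gamma> t u"
      by (rule variation_sumsI) (use assms in auto)
  qed (use assms in auto)
  finally show ?thesis by simp
qed

lemma arc_length_add:
  assumes "0 \<le> s" "s \<le> t" "t \<le> u" "u \<le> 1"
  shows "arc_length N \<gamma> s u = arc_length N \<gamma> s t + arc_length N \<gamma> t u"
proof (rule antisym)
  show "arc_length N \<gamma> s u \<le> arc_length N \<gamma> s t + arc_length N \<gamma> t u"
  proof (rule arc_length_le)
    fix v assume "v \<in> variation_sums N \<gamma> s u"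
    then obtain n \<tau> where v: "v = (\<Sum>i<n. N (\<gamma> (\<tau> (Suc i)) - \<gamma> (\<tau> i)))"
      and \<tau>: "mono_on {..n::nat} \<tau>" "\<tau> 0 = s" "\<tau> n = u"
      unfolding variation_sums_def by blast
    have "(\<Sum>i<n. N (\<gamma> (min (\<tau> (Suc i)) t) - \<gamma> (min (\<tau> i) t))) \<le> arc_length N \<gamma> s t"
    proof (rule le_arc_length)
      have "mono_on {..n} (\<lambda>i. min (\<tau> i) t)"
        by (intro mono_onI min.mono order_refl mono_onD[OF \<tau>(1)])
      then show "(\<Sum>i<n. N (\<gamma> (min (\<tau> (Suc i)) t) - \<gamma> (min (\<tau> i) t))) \<in> variation_sums N \<gamma> s t"
        by (rule variation_sumsI) (use assms \<tau> in auto)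
    qed (use assms in auto)
    then show "v \<le> arc_length N \<gamma> s t + arc_length N \<gamma> t u"
      using variation_sum_le_min_arc_length[OF \<tau>] assms unfolding v by fastforce
  qed (use assms in auto)
  \<comment> \<open>For the reverse inequality subdivisions are concatenated; the supremum over
    \<open>w\<close> is taken first with \<open>v\<close> fixed, then the supremum over
    \<open>v\<close>.\<close>
  have "arc_length N \<gamma> s t \<le> arc_length N \<gamma> s u - arc_length N \<gamma> t u"
  proof (rule arc_length_le)
    fix v assume v: "v \<in> variation_sums N \<gamma> s t"
    have "arc_length N \<gamma> t u \<le> arc_length N \<gamma> s u - v"
    proof (rule arc_length_le)
      fix w assume "w \<in> variation_sums N \<gamma> t u"
      with v have "v + w \<in> variation_sums N \<gamma> s u"
        by (rule variation_sums_concat)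
      then show "w \<le> arc_length N \<gamma> s u - v"
        using le_arc_length[of s u] assms by fastforce
    qed (use assms in auto)
    then show "v \<le> arc_length N \<gamma> s u - arc_length N \<gamma> t u" by simp
  qed (use assms in auto)
  then show "arc_length N \<gamma> s t + arc_length N \<gamma> t u \<le> arc_length N \<gamma> s u" by simp
qed

text \<open>The distribution function behind \<open>arc_measure\<close>. Monotonicity and right
  continuity are what its Lebesgue-Stieltjes measure requires.\<close>

definition F :: "real \<Rightarrow> real" where
  "F t = arc_length N \<gamma> 0 (max 0 (min 1 t))"

lemma F_diff: "0 \<le> s \<Longrightarrow> s \<le> t \<Longrightarrow> t \<le> 1 \<Longrightarrow> F t - F s = arc_length N \<gamma> s t"
  using arc_length_add[of 0 s t] by (simp add: F_def)

lemma F_mono: "s \<le> t \<Longrightarrow> F s \<le> F t"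
  using arc_length_add[of 0 "max 0 (min 1 s)" "max 0 (min 1 t)"]
    arc_length_nonneg[of "max 0 (min 1 s)" "max 0 (min 1 t)"]
  unfolding F_def by linarith

lemma continuous_on_clamp: "continuous_on UNIV (\<lambda>t. \<gamma> (max 0 (min 1 t)))"
  by (rule continuous_on_compose2[OF cont]) (auto intro!: continuous_intros)

text \<open>
  Truncated to \<open>[s, t]\<close>, a nearly optimal subdivision of \<open>[s, 1]\<close> has a variation sum that tends
  to \<open>0\<close> as \<open>t\<close> decreases to \<open>s\<close>, while the remaining part is at most the arc length on \<open>[t, 1]\<close>.
\<close>

lemma F_right_continuous: "continuous (at_right s) F"
proof -
  consider "s < 0" | "0 \<le> s" "s < 1" | "1 \<le> s" by linarith
  then have "(F \<longlongrightarrow> F s) (at_right s)"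
  proof cases
    case 1
    have "\<forall>\<^sub>F t in at_right s. F t = F s"
      using 1 by (auto simp: eventually_at_right F_def intro!: exI[of _ 0])
    then show ?thesis by (rule tendsto_eventually)
  next
    case 3
    have "\<forall>\<^sub>F t in at_right s. F t = F s"
      using 3 eventually_at_right_less[of s] by (auto elim!: eventually_mono simp: F_def)
    then show ?thesis by (rule tendsto_eventually)
  next
    case 2
    show ?thesis
    proof (rule tendstoI)
      fix e :: real assume "e > 0"
      then have "arc_length N \<gamma> s 1 - e / 2 < Sup (variation_sums N \<gamma> s 1)"
        by (simp add: arc_length_def)
      then obtain v where "v \<in> variation_sums N \<gamma> s 1" and v_gt: "arc_length N \<gamma> s 1 - e / 2 < v"
        using less_cSupD[of "variation_sums N \<gamma> s 1"] increment_in_variation_sums[of s 1 N \<gamma>] 2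
        by auto
      then obtain n \<tau> where v: "v = (\<Sum>i<n. N (\<gamma> (\<tau> (Suc i)) - \<gamma> (\<tau> i)))"
        and \<tau>: "mono_on {..n::nat} \<tau>" "\<tau> 0 = s" "\<tau> n = 1"
        unfolding variation_sums_def by blast
      have \<tau>_range: "s \<le> \<tau> i" if "i \<le> n" for i
        using mono_onD[OF \<tau>(1), of 0 i] that \<tau>(2) by auto
      \<comment> \<open>Clamping the parameter extends the path continuously to the whole line, so
        that \<open>S\<close> is continuous everywhere.\<close>
      define g where "g t = \<gamma> (max 0 (min 1 t))" for t
      define S where "S t = (\<Sum>i<n. N (g (min (\<tau> (Suc i)) t) - g (min (\<tau> i) t)))" for t
      have "continuous_on UNIV g"
        using continuous_on_clamp by (simp add: g_def[abs_def])
      then have "continuous_on UNIV S"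
        unfolding S_def
        by (intro continuous_on_sum continuous_on_is_norm_comp[OF norm] continuous_on_diff)
          (auto intro!: continuous_on_compose2[of UNIV g] continuous_intros)
      then have "(S \<longlongrightarrow> S s) (at_right s)"
        by (auto simp: continuous_on_def intro: tendsto_within_subset)
      \<comment> \<open>All points of the subdivision are at least \<open>s\<close>, so truncation
        at \<open>s\<close> collapses them to \<open>s\<close> and every increment vanishes.\<close>
      moreover have "S s = 0"
        unfolding S_def using \<tau>_range by (auto intro!: sum.neutral simp: min_absorb2 is_norm_eq_0[OF norm])
      ultimately have "\<forall>\<^sub>F t in at_right s. S t < e / 2"
        using order_tendstoD(2)[of S 0 "at_right s" "e / 2"] \<open>e > 0\<close> by simp
      moreover have "\<forall>\<^sub>F t in at_right s. s < t \<and> t < 1"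
        using 2 by (auto simp: eventually_at_right)
      ultimately show "\<forall>\<^sub>F t in at_right s. dist (F t) (F s) < e"
      proof eventually_elim
        case (elim t)
        have g_eq: "g (min (\<tau> i) t) = \<gamma> (min (\<tau> i) t)" if "i \<le> n" for i
        proof -
          have "0 \<le> min (\<tau> i) t" "min (\<tau> i) t \<le> 1"
            using \<tau>_range[OF that] 2 elim by auto
          then show ?thesis by (simp add: g_def max_absorb2 min_absorb2)
        qed
        have "S t = (\<Sum>i<n. N (\<gamma> (min (\<tau> (Suc i)) t) - \<gamma> (min (\<tau> i) t)))"
          unfolding S_def by (intro sum.cong refl) (simp add: g_eq)
        then have "v \<le> S t + arc_length N \<gamma> t 1"
          using variation_sum_le_min_arc_length[OF \<tau>, of t] 2 elim v by simp
        \<comment> \<open>The choice of \<open>v\<close> loses less than \<open>e / 2\<close> of the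
          arc length of \<open>[s, 1]\<close>, and \<open>S t\<close> is below \<open>e / 2\<close>;
          additivity cancels the arc length of \<open>[t, 1]\<close>.\<close>
        then have "arc_length N \<gamma> s t < e"
          using v_gt arc_length_add[of s t 1] 2 elim by simp
        moreover have "0 \<le> arc_length N \<gamma> s t"
          using arc_length_nonneg 2 elim by simp
        ultimately show ?case
          using F_diff[of s t] 2 elim by (simp add: dist_real_def)
      qed
    qed
  qed
  then show ?thesis
    by (simp add: continuous_within)
qed

end

subsection \<open>Integration along a rectifiable path\<close>

context rectifiable
begin

lemma arc_measure_eq: "arc_measure N \<gamma> = interval_measure F"
  by (simp add: arc_measure_def F_def[abs_def])

lemma emeasure_arc_measure_Ioc:
  "s \<le> t \<Longrightarrow> emeasure (arc_measure N \<gamma>) {s<..t} = ennreal (F t - F s)"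
  unfolding arc_measure_eq by (rule emeasure_interval_measure_Ioc[OF _ F_mono F_right_continuous])

lemma sets_arc_measure [simp]: "sets (arc_measure N \<gamma>) = sets borel"
  by (simp add: arc_measure_eq)

lemma measure_arc_measure_Ioc:
  "0 \<le> s \<Longrightarrow> s \<le> t \<Longrightarrow> t \<le> 1 \<Longrightarrow> measure (arc_measure N \<gamma>) {s<..t} = arc_length N \<gamma> s t"
  unfolding measure_def by (simp add: emeasure_arc_measure_Ioc F_diff arc_length_nonneg)

lemma emeasure_arc_measure_finite:
  assumes "A \<subseteq> {0..1}"
  shows "emeasure (arc_measure N \<gamma>) A < \<infinity>"
proof -
  \<comment> \<open>The left end -1 makes the half-open interval contain the point 0.\<close>
  have "emeasure (arc_measure N \<gamma>) A \<le> emeasure (arc_measure N \<gamma>) {-1<..1}"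
    using assms by (intro emeasure_mono) auto
  also have "\<dots> < \<infinity>"
    by (simp add: emeasure_arc_measure_Ioc)
  finally show ?thesis .
qed

text \<open>Continuity on a compact interval gives a bound. Measurability comes from the clamped
  version of \<open>w\<close>, which is continuous on the line and agrees with \<open>w\<close> on
  \<open>A\<close>.\<close>

lemma set_integrable_arc_measure:
  fixes w :: "real \<Rightarrow> real"
  assumes w: "continuous_on {0..1} w" and A: "A \<in> sets borel" "A \<subseteq> {0..1}"
  shows "set_integrable (arc_measure N \<gamma>) A w"
proof -
  obtain M where M: "\<And>t. t \<in> {0..1} \<Longrightarrow> norm (w t) \<le> M"
    using compact_imp_bounded[OF compact_continuous_image[OF w compact_Icc]]
    unfolding bounded_iff by blast
  have "continuous_on UNIV (\<lambda>t. w (max 0 (min 1 t)))"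
    by (rule continuous_on_compose2[OF w]) (auto intro!: continuous_intros)
  then have "(\<lambda>t. w (max 0 (min 1 t))) \<in> borel_measurable borel"
    by (rule borel_measurable_continuous_onI)
  then have "(\<lambda>t. w (max 0 (min 1 t))) \<in> borel_measurable (arc_measure N \<gamma>)"
    by (simp add: measurable_def space_borel arc_measure_eq)
  then have "integrable (arc_measure N \<gamma>) (\<lambda>t. indicator A t *\<^sub>R w (max 0 (min 1 t)))"
    by (rule integrableI_bounded_set_indicator[where B = M, rotated])
      (use A M emeasure_arc_measure_finite in auto)
  moreover have "indicator A t *\<^sub>R w (max 0 (min 1 t)) = indicator A t *\<^sub>R w t" for t
    using A(2) by (cases "t \<in> A") (auto simp: min_absorb2 max_absorb2)
  ultimately show ?thesis
    unfolding set_integrable_def by (simp only:)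
qed

text \<open>Since \<open>F\<close> is constant to the left of 0 and continuous there from the right,
  0 carries no mass. Half-open intervals are preferred from here on because they split without
  overlap.\<close>

lemma integral_Icc_eq_Ioc:
  fixes w :: "real \<Rightarrow> real"
  assumes "continuous_on {0..1} w"
  shows "(LINT t:{0..1}|arc_measure N \<gamma>. w t) = (LINT t:{0<..1}|arc_measure N \<gamma>. w t)"
proof -
  have "emeasure (arc_measure N \<gamma>) {0} \<le> emeasure (arc_measure N \<gamma>) {-1<..0}"
    by (intro emeasure_mono) auto
  also have "\<dots> = 0"
    by (simp add: emeasure_arc_measure_Ioc F_def)
  finally have "{0} \<in> null_sets (arc_measure N \<gamma>)"
    by auto
  then have "AE t in arc_measure N \<gamma>. t \<in> {0<..1} \<longleftrightarrow> t \<in> {0..1}"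
    by (rule AE_I') auto
  moreover have "set_borel_measurable (arc_measure N \<gamma>) A w"
    if "A \<in> sets borel" "A \<subseteq> {0..1}" for A
    using set_integrable_arc_measure[OF assms that]
    unfolding set_integrable_def set_borel_measurable_def by (rule borel_measurable_integrable)
  ultimately show ?thesis
    by (intro set_integral_cong_set) (simp_all add: subset_eq)
qed

lemma integral_Ioc_split:
  fixes w :: "real \<Rightarrow> real"
  assumes "continuous_on {0..1} w" "0 \<le> s" "s \<le> t" "t \<le> u" "u \<le> 1"
  shows "(LINT r:{s<..u}|arc_measure N \<gamma>. w r) =
    (LINT r:{s<..t}|arc_measure N \<gamma>. w r) + (LINT r:{t<..u}|arc_measure N \<gamma>. w r)"
proof -
  have "{s<..u} = {s<..t} \<union> {t<..u}" using assms by auto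
  moreover have "{s<..t} \<inter> {t<..u} = {}" by auto
  ultimately show ?thesis
    using assms by (auto intro!: set_integral_Un set_integrable_arc_measure)
qed

lemma integral_const_Ioc:
  assumes "0 \<le> s" "s \<le> t" "t \<le> 1"
  shows "(LINT r:{s<..t}|arc_measure N \<gamma>. m::real) = m * arc_length N \<gamma> s t"
  using assms by (subst set_integral_const)
    (auto simp: measure_arc_measure_Ioc emeasure_arc_measure_Ioc)

lemma integral_Ioc_ge:
  assumes "continuous_on {0..1} w" "0 \<le> s" "s \<le> t" "t \<le> 1"
    and "\<And>r. s < r \<Longrightarrow> r \<le> t \<Longrightarrow> m \<le> w r"
  shows "m * arc_length N \<gamma> s t \<le> (LINT r:{s<..t}|arc_measure N \<gamma>. w r)"
  unfolding integral_const_Ioc[OF assms(2-4), symmetric]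
  using assms by (intro set_integral_mono set_integrable_arc_measure) (auto intro: continuous_intros)

lemma integral_Ioc_le:
  assumes "continuous_on {0..1} w" "0 \<le> s" "s \<le> t" "t \<le> 1"
    and "\<And>r. s < r \<Longrightarrow> r \<le> t \<Longrightarrow> w r \<le> m"
  shows "(LINT r:{s<..t}|arc_measure N \<gamma>. w r) \<le> m * arc_length N \<gamma> s t"
  unfolding integral_const_Ioc[OF assms(2-4), symmetric]
  using assms by (intro set_integral_mono set_integrable_arc_measure) (auto intro: continuous_intros)

end

section \<open>Comparing path integrals of \<open>1 / h\<close> with increments of
  \<open>ln h\<close>\<close>

text \<open>A substitute for differentiation: an inequality between increments that holds up to a
  factor \<open>K > 1\<close> on all short subintervals is summed over an equidistant partition, and
  then \<open>K\<close> tends to 1.\<close>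

lemma increment_le_of_locally:
  fixes \<phi> G :: "real \<Rightarrow> real"
  assumes "u \<le> v"
    and local: "\<And>K. K > 1 \<Longrightarrow> \<exists>\<delta>>0. \<forall>s t. u \<le> s \<and> s \<le> t \<and> t \<le> v \<and> t - s < \<delta> \<longrightarrow>
      \<phi> t - \<phi> s \<le> K * (G t - G s)"
  shows "\<phi> v - \<phi> u \<le> G v - G u"
proof -
  have K: "\<phi> v - \<phi> u \<le> K * (G v - G u)" if K: "K > 1" for K
  proof -
    obtain \<delta> where "\<delta> > 0"
      and \<delta>: "\<And>s t. u \<le> s \<Longrightarrow> s \<le> t \<Longrightarrow> t \<le> v \<Longrightarrow> t - s < \<delta> \<Longrightarrow> \<phi> t - \<phi> s \<le> K * (G t - G s)"
      using local[OF K] by blast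
    obtain n :: nat where n: "(v - u) / \<delta> < real n"
      using reals_Archimedean2 by blast
    moreover have "0 \<le> (v - u) / \<delta>" using \<open>u \<le> v\<close> \<open>\<delta> > 0\<close> by simp
    ultimately have "n > 0" by (intro Nat.gr0I) simp
    define \<tau> where "\<tau> i = u + real i * ((v - u) / n)" for i
    have step: "\<tau> (Suc i) - \<tau> i = (v - u) / n" for i
      by (simp add: \<tau>_def distrib_right add_divide_distrib)
    have \<tau>: "\<tau> 0 = u" "\<tau> n = v"
      using \<open>n > 0\<close> by (auto simp: \<tau>_def)
    have mono: "\<tau> i \<le> \<tau> j" if "i \<le> j" for i j
      unfolding \<tau>_def using \<open>u \<le> v\<close> that by (intro add_left_mono mult_right_mono) auto
    have "\<phi> v - \<phi> u = (\<Sum>i<n. \<phi> (\<tau> (Suc i)) - \<phi> (\<tau> i))"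
      by (simp add: sum_lessThan_telescope[of "\<lambda>i. \<phi> (\<tau> i)"] \<tau>)
    also have "\<dots> \<le> (\<Sum>i<n. K * (G (\<tau> (Suc i)) - G (\<tau> i)))"
    proof (intro sum_mono \<delta>)
      fix i assume i: "i \<in> {..<n}"
      show "u \<le> \<tau> i" using mono[of 0 i] \<tau> by simp
      show "\<tau> (Suc i) \<le> v" using mono[of "Suc i" n] \<tau> i by simp
      show "\<tau> i \<le> \<tau> (Suc i)" by (rule mono) simp
      show "\<tau> (Suc i) - \<tau> i < \<delta>"
        unfolding step using n \<open>n > 0\<close> \<open>\<delta> > 0\<close> by (simp add: field_simps)
    qed
    also have "\<dots> = K * (G v - G u)"
      by (simp add: sum_distrib_left[symmetric] sum_lessThan_telescope[of "\<lambda>i. G (\<tau> i)"] \<tau>)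
    finally show ?thesis .
  qed
  have "((\<lambda>K. K * (G v - G u)) \<longlongrightarrow> 1 * (G v - G u)) (at_right 1)"
    by (intro tendsto_intros)
  moreover have "\<forall>\<^sub>F K in at_right 1. \<phi> v - \<phi> u \<le> K * (G v - G u)"
    using eventually_at_right_less[of "1::real"] by eventually_elim (rule K)
  ultimately have "\<phi> v - \<phi> u \<le> 1 * (G v - G u)"
    by (rule tendsto_lowerbound) simp
  then show ?thesis by simp
qed

text \<open>Uniform continuity of \<open>ln h\<close> on a compact interval turns a small difference
  of logarithms into a ratio close to 1.\<close>

lemma uniform_ratio_bound:
  fixes h :: "real \<Rightarrow> real"
  assumes "continuous_on {u..v} h" "\<And>t. t \<in> {u..v} \<Longrightarrow> h t > 0" "k > 1"
  obtains \<delta> where "\<delta> > 0"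
    "\<And>s t. s \<in> {u..v} \<Longrightarrow> t \<in> {u..v} \<Longrightarrow> \<bar>t - s\<bar> < \<delta> \<Longrightarrow> h t \<le> k * h s"
proof -
  have "continuous_on {u..v} (\<lambda>t. ln (h t))"
    using assms by (intro continuous_on_ln) force+
  then have "uniformly_continuous_on {u..v} (\<lambda>t. ln (h t))"
    by (intro compact_uniformly_continuous compact_Icc)
  moreover have "ln k > 0" using \<open>k > 1\<close> by simp
  ultimately obtain \<delta> where "\<delta> > 0"
    and \<delta>: "\<And>s t. s \<in> {u..v} \<Longrightarrow> t \<in> {u..v} \<Longrightarrow> dist t s < \<delta> \<Longrightarrow> dist (ln (h t)) (ln (h s)) < ln k"
    unfolding uniformly_continuous_on_def by metis
  show thesis
  proof (rule that[OF \<open>\<delta> > 0\<close>])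
    fix s t assume st: "s \<in> {u..v}" "t \<in> {u..v}" "\<bar>t - s\<bar> < \<delta>"
    then have "ln (h t) \<le> ln k + ln (h s)"
      using \<delta>[of s t] by (auto simp: dist_real_def)
    also have "\<dots> = ln (k * h s)"
      using assms(2)[OF st(1)] \<open>k > 1\<close> by (simp add: ln_mult)
    finally show "h t \<le> k * h s"
      using assms(2)[OF st(1)] assms(2)[OF st(2)] \<open>k > 1\<close> by simp
  qed
qed

locale rectifiable_weight = rectifiable N \<gamma>
  for N :: "'a::euclidean_space \<Rightarrow> real" and \<gamma> +
  fixes h :: "real \<Rightarrow> real"
  assumes h_cont: "continuous_on {0..1} h"
    and h_pos: "t \<in> {0..1} \<Longrightarrow> h t > 0"
begin

lemma continuous_on_inverse_h: "continuous_on {0..1} (\<lambda>t. 1 / h t)"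
  using h_cont h_pos by (intro continuous_intros) force+

lemma ratio_bound:
  assumes "k > 1"
  obtains \<delta> where "\<delta> > 0"
    "\<And>s t. s \<in> {0..1} \<Longrightarrow> t \<in> {0..1} \<Longrightarrow> \<bar>t - s\<bar> < \<delta> \<Longrightarrow> h t \<le> k * h s"
  using uniform_ratio_bound[OF h_cont h_pos assms] by blast

text \<open>By \<open>ln x \<le> x - 1\<close> the increment of \<open>ln h\<close> over
  \<open>[s, t]\<close> is at most the arc length divided by \<open>h s\<close>, and on a short
  interval \<open>1 / h\<close> is at least \<open>1 / (K * h s)\<close>.\<close>

lemma ln_increment_le_integral:
  assumes lip: "\<And>s t. 0 \<le> s \<Longrightarrow> s \<le> t \<Longrightarrow> t \<le> 1 \<Longrightarrow> h t - h s \<le> N (\<gamma> t - \<gamma> s)"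
  shows "ln (h 1) - ln (h 0) \<le> (LINT t:{0<..1}|arc_measure N \<gamma>. 1 / h t)"
proof -
  define G where "G t = (LINT r:{0<..t}|arc_measure N \<gamma>. 1 / h r)" for t
  have "ln (h 1) - ln (h 0) \<le> G 1 - G 0"
  proof (rule increment_le_of_locally)
    fix K :: real assume "K > 1"
    obtain \<delta> where "\<delta> > 0"
      and \<delta>: "\<And>s t. s \<in> {0..1} \<Longrightarrow> t \<in> {0..1} \<Longrightarrow> \<bar>t - s\<bar> < \<delta> \<Longrightarrow> h t \<le> K * h s"
      by (rule ratio_bound[OF \<open>K > 1\<close>]) blast
    have "ln (h t) - ln (h s) \<le> K * (G t - G s)"
      if st: "0 \<le> s" "s \<le> t" "t \<le> 1" "t - s < \<delta>" for s t
    proof -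
      have pos: "h s > 0" "h t > 0" using h_pos st by auto
      have "1 / (K * h s) * arc_length N \<gamma> s t \<le> (LINT r:{s<..t}|arc_measure N \<gamma>. 1 / h r)"
      proof (rule integral_Ioc_ge[OF continuous_on_inverse_h])
        fix r assume r: "s < r" "r \<le> t"
        then show "1 / (K * h s) \<le> 1 / h r"
          using \<delta>[of s r] st h_pos[of r] pos \<open>K > 1\<close> by (intro divide_left_mono mult_pos_pos) auto
      qed (use st in auto)
      also have "\<dots> = G t - G s"
        using integral_Ioc_split[OF continuous_on_inverse_h, of 0 s t] st by (simp add: G_def)
      finally have G: "arc_length N \<gamma> s t / h s \<le> K * (G t - G s)"
        using pos \<open>K > 1\<close> by (simp add: field_simps)
      have "ln (h t) - ln (h s) = ln (h t / h s)"
        using pos by (simp add: ln_div)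
      also have "\<dots> \<le> h t / h s - 1"
        using pos by (intro ln_le_minus_one) simp
      also have "\<dots> = (h t - h s) / h s"
        using pos by (simp add: diff_divide_distrib)
      also have "\<dots> \<le> arc_length N \<gamma> s t / h s"
        using lip[of s t] increment_le_arc_length[of s t] st pos by (intro divide_right_mono) auto
      finally show ?thesis using G by linarith
    qed
    then show "\<exists>\<delta>>0. \<forall>s t. 0 \<le> s \<and> s \<le> t \<and> t \<le> 1 \<and> t - s < \<delta> \<longrightarrow>
        ln (h t) - ln (h s) \<le> K * (G t - G s)"
      using \<open>\<delta> > 0\<close> by blast
  qed simp
  then show ?thesis by (simp add: G_def set_lebesgue_integral_def)
qed

text \<open>An upper estimate for pieces on which the height is monotone and the path is at most
  \<open>c\<close> times as fast as the height. The sign \<sigma> is 1 for growing and -1 for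
  shrinking height.\<close>

lemma integral_le_ln_increment:
  assumes uv: "0 \<le> u" "u \<le> v" "v \<le> 1" and "c > 0" and \<sigma>: "\<sigma> = 1 \<or> \<sigma> = - 1"
    and speed: "\<And>s t. u \<le> s \<Longrightarrow> s \<le> t \<Longrightarrow> t \<le> v \<Longrightarrow> N (\<gamma> t - \<gamma> s) \<le> c * (\<sigma> * (h t - h s))"
  shows "(LINT t:{u<..v}|arc_measure N \<gamma>. 1 / h t) \<le> c * (\<sigma> * (ln (h v) - ln (h u)))"
proof -
  define G where "G t = (LINT r:{u<..t}|arc_measure N \<gamma>. 1 / h r)" for t
  have "G v - G u \<le> c * (\<sigma> * ln (h v)) - c * (\<sigma> * ln (h u))"
  proof (rule increment_le_of_locally[OF \<open>u \<le> v\<close>])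
    fix K :: real assume "K > 1"
    \<comment> \<open>Two estimates lose a factor \<open>k\<close>: replacing \<open>1 / h r\<close>
      by \<open>1 / h s\<close>, and bounding the relative increment of \<open>h\<close> by that of
      \<open>ln h\<close>.\<close>
    define k where "k = sqrt K"
    have k: "k > 1" "k * k = K"
      using \<open>K > 1\<close> by (auto simp: k_def)
    obtain \<delta> where "\<delta> > 0"
      and \<delta>: "\<And>s t. s \<in> {0..1} \<Longrightarrow> t \<in> {0..1} \<Longrightarrow> \<bar>t - s\<bar> < \<delta> \<Longrightarrow> h t \<le> k * h s"
      by (rule ratio_bound[OF \<open>k > 1\<close>]) blast
    have "G t - G s \<le> K * (c * (\<sigma> * ln (h t)) - c * (\<sigma> * ln (h s)))"
      if st: "u \<le> s" "s \<le> t" "t \<le> v" "t - s < \<delta>" for s t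
    proof -
      have pos: "h s > 0" "h t > 0" using h_pos st uv by auto
      have "0 \<le> c * (\<sigma> * (h t - h s))"
        using speed[of s t] is_norm_nonneg[OF norm, of "\<gamma> t - \<gamma> s"] st by linarith
      then have incr: "0 \<le> \<sigma> * (h t - h s)"
        using \<open>c > 0\<close> by (simp add: zero_le_mult_iff)
      have "G t - G s = (LINT r:{s<..t}|arc_measure N \<gamma>. 1 / h r)"
        using integral_Ioc_split[OF continuous_on_inverse_h, of u s t] st uv by (simp add: G_def)
      also have "\<dots> \<le> k / h s * arc_length N \<gamma> s t"
      proof (rule integral_Ioc_le[OF continuous_on_inverse_h])
        fix r assume r: "s < r" "r \<le> t"
        then have "h s \<le> k * h r" "h r > 0"
          using \<delta>[of r s] st uv h_pos[of r] by auto
        then show "1 / h r \<le> k / h s"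
          using pos by (simp add: field_simps)
      qed (use st uv in auto)
      also have "\<dots> \<le> k / h s * (c * (\<sigma> * h t) - c * (\<sigma> * h s))"
      proof (rule mult_left_mono)
        show "arc_length N \<gamma> s t \<le> c * (\<sigma> * h t) - c * (\<sigma> * h s)"
        proof (rule arc_length_le[OF \<open>s \<le> t\<close>])
          fix x assume "x \<in> variation_sums N \<gamma> s t"
          then show "x \<le> c * (\<sigma> * h t) - c * (\<sigma> * h s)"
            using variation_sums_le[of x N \<gamma> s t "\<lambda>t. c * (\<sigma> * h t)"] speed st
            by (simp add: right_diff_distrib)
        qed
      qed (use k pos in simp)
      also have "\<dots> = c * k * (\<sigma> * (h t - h s) / h s)"
        by (simp add: field_simps)
      also have "\<dots> \<le> c * k * (k * (\<sigma> * (ln (h t) - ln (h s))))"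
      proof (rule mult_left_mono)
        show "\<sigma> * (h t - h s) / h s \<le> k * (\<sigma> * (ln (h t) - ln (h s)))"
          using \<sigma>
        proof
          assume "\<sigma> = 1"
          \<comment> \<open>The logarithmic inequality for growing height has the larger value
            \<open>h t\<close> in the denominator; exchanging it for \<open>h s\<close> costs the
            second factor \<open>k\<close>.\<close>
          have "h t \<le> k * h s" using \<delta>[of s t] st uv by auto
          then have "(h t - h s) / h s \<le> k * ((h t - h s) / h t)"
            using pos incr \<open>\<sigma> = 1\<close> mult_right_mono[of "h t" "k * h s" "h t - h s"]
            by (simp add: divide_simps mult.commute mult.left_commute)
          also have "(h t - h s) / h t = 1 - h s / h t"
            using pos by (simp add: diff_divide_distrib)
          also have "\<dots> \<le> - ln (h s / h t)"
            using ln_le_minus_one[of "h s / h t"] pos by simp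
          also have "\<dots> = ln (h t) - ln (h s)"
            using pos by (simp add: ln_div)
          finally show ?thesis using \<open>\<sigma> = 1\<close> k by simp
        next
          assume "\<sigma> = - 1"
          have "(h s - h t) / h s = 1 - h t / h s"
            using pos by (simp add: diff_divide_distrib)
          also have "\<dots> \<le> - ln (h t / h s)"
            using ln_le_minus_one[of "h t / h s"] pos by simp
          also have "\<dots> = ln (h s) - ln (h t)"
            using pos by (simp add: ln_div)
          \<comment> \<open>For shrinking height the logarithmic bound already has the denominator
            \<open>h s\<close>; the factor \<open>k > 1\<close> brings it to the common
            form.\<close>
          also have "\<dots> \<le> k * (ln (h s) - ln (h t))"
            using k incr pos \<open>\<sigma> = - 1\<close> mult_right_mono[of 1 k "ln (h s) - ln (h t)"] by simp
          finally show ?thesis using \<open>\<sigma> = - 1\<close> by simp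
        qed
      qed (use \<open>c > 0\<close> k in simp)
      also have "\<dots> = K * (c * (\<sigma> * ln (h t)) - c * (\<sigma> * ln (h s)))"
        by (simp add: k(2)[symmetric] algebra_simps)
      finally show ?thesis .
    qed
    then show "\<exists>\<delta>>0. \<forall>s t. u \<le> s \<and> s \<le> t \<and> t \<le> v \<and> t - s < \<delta> \<longrightarrow>
        G t - G s \<le> K * (c * (\<sigma> * ln (h t)) - c * (\<sigma> * ln (h s)))"
      using \<open>\<delta> > 0\<close> by blast
  qed
  then show ?thesis by (simp add: G_def set_lebesgue_integral_def right_diff_distrib)
qed

end

subsection \<open>The half-plane\<close>

text \<open>Both \<open>infnorm\<close> and \<open>lp_norm p\<close> are instances, so the
  counterexample is built only once, with \<open>c\<close> measuring the diagonal
  directions.\<close>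

locale plane_norm =
  fixes N :: "real ^ 2 \<Rightarrow> real" and c :: real
  assumes norm: "is_norm N"
    and component_le: "\<bar>x $ i\<bar> \<le> N x"
    and vertical: "N (vector [0, 1]) = 1"
    and diagonal: "N (vector [1, 1]) = c" "N (vector [1, -1]) = c"
begin

lemma c_ge_1: "1 \<le> c"
  using component_le[of "vector [1, 1]" 1] by (simp add: diagonal)

lemma diagonal_scaled: "N (vector [x, x]) = c * \<bar>x\<bar>" "N (vector [x, - x]) = c * \<bar>x\<bar>"
proof -
  have "vector [x, x] = x *\<^sub>R (vector [1, 1] :: real ^ 2)"
    "vector [x, - x] = x *\<^sub>R (vector [1, -1] :: real ^ 2)"
    by (simp_all add: vec_eq_iff forall_2)
  then show "N (vector [x, x]) = c * \<bar>x\<bar>" "N (vector [x, - x]) = c * \<bar>x\<bar>"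
    by (simp_all add: is_norm_scaleR[OF norm] diagonal)
qed

lemma convex_lower_half_plane: "convex lower_half_plane"
  unfolding lower_half_plane_def cart_eq_inner_axis inner_commute[of _ "axis 2 1"]
  by (rule convex_halfspace_lt)

lemma proper_domain_lower_half_plane: "proper_domain N lower_half_plane"
proof -
  have "vector [0, -1] \<in> lower_half_plane" "0 \<notin> lower_half_plane"
    by (auto simp: lower_half_plane_def)
  moreover have "open lower_half_plane"
    unfolding lower_half_plane_def by (rule open_halfspace_component_lt_cart)
  ultimately show ?thesis
    unfolding proper_domain_def norm_topology_eq_euclidean[OF norm]
    using convex_connected[OF convex_lower_half_plane] by auto
qed

text \<open>The vertical projection to the boundary line is a nearest point: \<open>vertical\<close>
  gives the distance to it, and \<open>component_le\<close> keeps all other boundary points at least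
  as far away.\<close>

lemma bdist_lower_half_plane:
  assumes "x \<in> lower_half_plane"
  shows "bdist N lower_half_plane x = - (x $ 2)"
proof -
  have "frontier lower_half_plane = {x :: real ^ 2. x $ 2 = 0}"
    by (auto simp: frontier_def lower_half_plane_def interior_open open_halfspace_component_lt_cart)
  then have "bdist N lower_half_plane x = (INF z\<in>{z. z $ 2 = 0}. N (x - z))"
    by (simp add: bdist_def norm_topology_eq_euclidean[OF norm])
  also have "\<dots> = - (x $ 2)"
  proof (rule cInf_eq_minimum)
    have "x - vector [x $ 1, 0] = (x $ 2) *\<^sub>R vector [0, 1]"
      by (simp add: vec_eq_iff forall_2)
    then have "N (x - vector [x $ 1, 0]) = - (x $ 2)"
      using assms by (simp add: is_norm_scaleR[OF norm] vertical lower_half_plane_def)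
    then show "- (x $ 2) \<in> (\<lambda>z. N (x - z)) ` {z. z $ 2 = 0}"
      by (intro image_eqI[of _ _ "vector [x $ 1, 0]"]) auto
    fix y assume "y \<in> (\<lambda>z. N (x - z)) ` {z. z $ 2 = 0}"
    then obtain z where "y = N (x - z)" "z $ 2 = 0" by blast
    then show "- (x $ 2) \<le> y"
      using component_le[of "x - z" 2] by simp
  qed
  finally show ?thesis .
qed

lemma pathin_iff: "pathin (norm_topology N) \<gamma> \<longleftrightarrow> continuous_on {0..1} \<gamma>"
  by (simp add: pathin_def norm_topology_eq_euclidean[OF norm])

lemma rectifiable_weight_height:
  assumes "rectifiable_path_in N lower_half_plane x y \<gamma>"
  shows "rectifiable_weight N \<gamma> (\<lambda>t. - (\<gamma> t $ 2))"
  using assms norm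
  by unfold_locales
    (auto simp: rectifiable_path_in_def pathin_iff lower_half_plane_def image_subset_iff
      intro!: continuous_intros)

lemma qh_length_eq:
  assumes "rectifiable_path_in N lower_half_plane x y \<gamma>"
  shows "qh_length N lower_half_plane \<gamma> = (LINT t:{0<..1}|arc_measure N \<gamma>. 1 / - (\<gamma> t $ 2))"
proof -
  interpret rectifiable_weight N \<gamma> "\<lambda>t. - (\<gamma> t $ 2)"
    by (rule rectifiable_weight_height[OF assms])
  have "\<gamma> t \<in> lower_half_plane" if "t \<in> {0..1}" for t
    using assms that by (auto simp: rectifiable_path_in_def)
  then have "qh_length N lower_half_plane \<gamma> = (LINT t:{0..1}|arc_measure N \<gamma>. 1 / - (\<gamma> t $ 2))"
    unfolding qh_length_def by (intro set_lebesgue_integral_cong) (auto simp: bdist_lower_half_plane)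
  then show ?thesis
    using integral_Icc_eq_Ioc[OF continuous_on_inverse_h] by simp
qed

text \<open>A real infimum bounds its set from below only if the set is bounded below; here 0 is a
  bound, because the weight is positive.\<close>

lemma qh_dist_le:
  assumes "rectifiable_path_in N lower_half_plane x y \<gamma>"
  shows "qh_dist N lower_half_plane x y \<le> qh_length N lower_half_plane \<gamma>"
  unfolding qh_dist_def
proof (rule cINF_lower)
  show "bdd_below (qh_length N lower_half_plane ` {\<gamma>. rectifiable_path_in N lower_half_plane x y \<gamma>})"
  proof (rule bdd_belowI2[of _ 0])
    fix \<rho> assume "\<rho> \<in> {\<gamma>. rectifiable_path_in N lower_half_plane x y \<gamma>}"
    then have \<rho>: "rectifiable_path_in N lower_half_plane x y \<rho>" by simp
    interpret rectifiable_weight N \<rho> "\<lambda>t. - (\<rho> t $ 2)"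
      by (rule rectifiable_weight_height[OF \<rho>])
    have "0 * arc_length N \<rho> 0 1 \<le> (LINT t:{0<..1}|arc_measure N \<rho>. 1 / - (\<rho> t $ 2))"
      by (rule integral_Ioc_ge[OF continuous_on_inverse_h])
        (use h_pos in \<open>auto intro!: less_imp_le simp: divide_nonneg_neg\<close>)
    then show "0 \<le> qh_length N lower_half_plane \<rho>"
      by (simp add: qh_length_eq[OF \<rho>])
  qed
qed (use assms in simp)

text \<open>A Lipschitz bound in \<open>N\<close> controls all variation sums by a linear function
  and, by comparison of norms, gives Euclidean continuity.\<close>

lemma rectifiable_path_inI:
  assumes lip: "\<And>s t. 0 \<le> s \<Longrightarrow> s \<le> t \<Longrightarrow> t \<le> 1 \<Longrightarrow> N (\<gamma> t - \<gamma> s) \<le> L * (t - s)"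
    and "\<And>t. 0 \<le> t \<Longrightarrow> t \<le> 1 \<Longrightarrow> \<gamma> t $ 2 < 0"
    and "\<gamma> 0 = x" "\<gamma> 1 = y"
  shows "rectifiable_path_in N lower_half_plane x y \<gamma>"
proof -
  have "bdd_above (variation_sums N \<gamma> 0 1)"
  proof (rule bdd_aboveI)
    fix v assume "v \<in> variation_sums N \<gamma> 0 1"
    then show "v \<le> L"
      using variation_sums_le[of v N \<gamma> 0 1 "\<lambda>t. L * t"] lip by (simp add: right_diff_distrib)
  qed
  moreover have "continuous_on {0..1} \<gamma>"
  proof -
    obtain m where m: "m > 0" "\<And>x. m * norm x \<le> N x"
      by (rule is_norm_ge_norm[OF norm]) blast
    have *: "norm (\<gamma> t - \<gamma> s) \<le> L / m * (t - s)" if "0 \<le> s" "s \<le> t" "t \<le> 1" for s t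
      using order_trans[OF m(2) lip[OF that]] m(1) by (simp add: field_simps)
    \<comment> \<open>A Lipschitz constant must be nonnegative; the estimate across the whole
      parameter interval shows this for \<open>L / m\<close>.\<close>
    have "norm (\<gamma> 1 - \<gamma> 0) \<le> L / m"
      using *[of 0 1] by simp
    then have "0 \<le> L / m"
      by (rule order_trans[OF norm_ge_zero])
    then have "(L / m)-lipschitz_on {0..1} \<gamma>"
      by (rule lipschitz_on_leI[rotated])
        (use * in \<open>auto simp: dist_norm norm_minus_commute\<close>)
    then show ?thesis
      by (rule lipschitz_on_continuous_on)
  qed
  ultimately show ?thesis
    using assms by (auto simp: rectifiable_path_in_def pathin_iff lower_half_plane_def)
qed

text \<open>The segment works by convexity. Nonemptiness of the set of paths is needed to bound the
  infimum \<open>qh_dist\<close> from below.\<close>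

lemma ex_rectifiable_path_in:
  assumes "x \<in> lower_half_plane" "y \<in> lower_half_plane"
  shows "\<exists>\<gamma>. rectifiable_path_in N lower_half_plane x y \<gamma>"
proof -
  define \<gamma> where "\<gamma> t = x + t *\<^sub>R (y - x)" for t
  have "rectifiable_path_in N lower_half_plane x y \<gamma>"
  proof (rule rectifiable_path_inI)
    fix s t :: real assume st: "0 \<le> s" "s \<le> t" "t \<le> 1"
    have "\<gamma> t - \<gamma> s = (t - s) *\<^sub>R (y - x)"
      by (simp add: \<gamma>_def algebra_simps)
    then have "N (\<gamma> t - \<gamma> s) = \<bar>t - s\<bar> * N (y - x)"
      by (simp only: is_norm_scaleR[OF norm])
    then show "N (\<gamma> t - \<gamma> s) \<le> N (y - x) * (t - s)"
      using st by simp
  next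
    fix t :: real assume t: "0 \<le> t" "t \<le> 1"
    have "(1 - t) *\<^sub>R x + t *\<^sub>R y \<in> lower_half_plane"
      using convexD[OF convex_lower_half_plane assms] t by simp
    then show "\<gamma> t $ 2 < 0"
      by (simp add: \<gamma>_def lower_half_plane_def algebra_simps)
  qed (auto simp: \<gamma>_def)
  then show ?thesis by blast
qed

lemma ln_height_le_qh_dist:
  assumes "x \<in> lower_half_plane" "y \<in> lower_half_plane"
  shows "ln (- (y $ 2)) - ln (- (x $ 2)) \<le> qh_dist N lower_half_plane x y"
  unfolding qh_dist_def
proof (rule cINF_greatest)
  show "{\<gamma>. rectifiable_path_in N lower_half_plane x y \<gamma>} \<noteq> {}"
    using ex_rectifiable_path_in[OF assms] by blast
  fix \<gamma> assume "\<gamma> \<in> {\<gamma>. rectifiable_path_in N lower_half_plane x y \<gamma>}"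
  then have \<gamma>: "rectifiable_path_in N lower_half_plane x y \<gamma>" by simp
  interpret rectifiable_weight N \<gamma> "\<lambda>t. - (\<gamma> t $ 2)"
    by (rule rectifiable_weight_height[OF \<gamma>])
  have "- (\<gamma> t $ 2) - - (\<gamma> s $ 2) \<le> N (\<gamma> t - \<gamma> s)" for s t
    using component_le[of "\<gamma> t - \<gamma> s" 2] by simp
  then have "ln (- (\<gamma> 1 $ 2)) - ln (- (\<gamma> 0 $ 2)) \<le> qh_length N lower_half_plane \<gamma>"
    unfolding qh_length_eq[OF \<gamma>] by (rule ln_increment_le_integral)
  then show "ln (- (y $ 2)) - ln (- (x $ 2)) \<le> qh_length N lower_half_plane \<gamma>"
    using \<gamma> by (simp add: rectifiable_path_in_def)
qed

text \<open>The weight is at least \<open>1 / H\<close> along the path, and the arc length is at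
  least the horizontal displacement.\<close>

lemma qh_length_ge_of_height_le:
  assumes \<gamma>: "rectifiable_path_in N lower_half_plane x y \<gamma>"
    and H: "\<And>t. 0 \<le> t \<Longrightarrow> t \<le> 1 \<Longrightarrow> - (\<gamma> t $ 2) \<le> H"
  shows "\<bar>y $ 1 - x $ 1\<bar> / H \<le> qh_length N lower_half_plane \<gamma>"
proof -
  interpret rectifiable_weight N \<gamma> "\<lambda>t. - (\<gamma> t $ 2)"
    by (rule rectifiable_weight_height[OF \<gamma>])
  have "H > 0" using H[of 0] h_pos[of 0] by simp
  have "\<bar>y $ 1 - x $ 1\<bar> \<le> arc_length N \<gamma> 0 1"
    using component_le[of "\<gamma> 1 - \<gamma> 0" 1] increment_le_arc_length[of 0 1] \<gamma>
    by (simp add: rectifiable_path_in_def)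
  then have "\<bar>y $ 1 - x $ 1\<bar> / H \<le> 1 / H * arc_length N \<gamma> 0 1"
    using \<open>H > 0\<close> by (simp add: divide_right_mono)
  also have "\<dots> \<le> (LINT t:{0<..1}|arc_measure N \<gamma>. 1 / - (\<gamma> t $ 2))"
  proof (rule integral_Ioc_ge[OF continuous_on_inverse_h])
    fix t :: real assume "0 < t" "t \<le> 1"
    then show "1 / H \<le> 1 / - (\<gamma> t $ 2)"
      using H[of t] h_pos[of t] \<open>H > 0\<close> by (intro divide_left_mono mult_pos_pos) auto
  qed auto
  finally show ?thesis by (simp add: qh_length_eq[OF \<gamma>])
qed

section \<open>Two explicit paths and the counterexample\<close>

text \<open>Along the diagonal segment the height grows from 1 to 2 while the path moves
  \<open>c\<close> times as fast as the height. The sign \<sigma> selects the diagonal.\<close>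

lemma qh_dist_diagonal_le:
  assumes "\<sigma> = 1 \<or> \<sigma> = - 1"
  shows "qh_dist N lower_half_plane (vector [0, -1]) (vector [\<sigma>, -2]) \<le> c * ln 2"
proof -
  define \<gamma> :: "real \<Rightarrow> real ^ 2" where "\<gamma> t = vector [\<sigma> * t, - (1 + t)]" for t
  have speed: "N (\<gamma> t - \<gamma> s) = c * \<bar>t - s\<bar>" for s t
  proof -
    have "\<gamma> t - \<gamma> s = vector [\<sigma> * (t - s), - (t - s)]"
      by (simp add: \<gamma>_def vec_eq_iff forall_2 algebra_simps)
    moreover have "vector [- (t - s), - (t - s)] = (vector [s - t, s - t] :: real ^ 2)" by simp
    ultimately show ?thesis
      using assms diagonal_scaled(2)[of "t - s"] diagonal_scaled(1)[of "s - t"] by auto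
  qed
  have \<gamma>: "rectifiable_path_in N lower_half_plane (vector [0, -1]) (vector [\<sigma>, -2]) \<gamma>"
  proof (rule rectifiable_path_inI)
    show "N (\<gamma> t - \<gamma> s) \<le> c * (t - s)" if "s \<le> t" for s t
      using that by (simp add: speed)
  qed (auto simp: \<gamma>_def)
  interpret rectifiable_weight N \<gamma> "\<lambda>t. - (\<gamma> t $ 2)"
    by (rule rectifiable_weight_height[OF \<gamma>])
  have "(LINT t:{0<..1}|arc_measure N \<gamma>. 1 / - (\<gamma> t $ 2))
    \<le> c * (1 * (ln (- (\<gamma> 1 $ 2)) - ln (- (\<gamma> 0 $ 2))))"
    by (rule integral_le_ln_increment) (use c_ge_1 speed in \<open>auto simp: \<gamma>_def\<close>)
  then show ?thesis
    using qh_dist_le[OF \<gamma>] by (simp add: qh_length_eq[OF \<gamma>] \<gamma>_def)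
qed

text \<open>The height grows from 2 to 3 on the first half and returns to 2 on the second; each half
  costs at most \<open>c * ln (3 / 2)\<close>.\<close>

lemma qh_dist_tent_le:
  "qh_dist N lower_half_plane (vector [-1, -2]) (vector [1, -2]) \<le> c * ln (9 / 4)"
proof -
  define \<gamma> :: "real \<Rightarrow> real ^ 2" where "\<gamma> t = vector [2 * t - 1, \<bar>2 * t - 1\<bar> - 3]" for t
  have up: "N (\<gamma> t - \<gamma> s) = c * (2 * t - 2 * s)" if "s \<le> t" "t \<le> 1 / 2" for s t
  proof -
    have "\<gamma> t - \<gamma> s = vector [2 * (t - s), - (2 * (t - s))]"
      using that by (simp add: \<gamma>_def vec_eq_iff forall_2)
    then show ?thesis using that by (simp only: diagonal_scaled) simp
  qed
  have down: "N (\<gamma> t - \<gamma> s) = c * (2 * t - 2 * s)" if "1 / 2 \<le> s" "s \<le> t" for s t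
  proof -
    have "\<gamma> t - \<gamma> s = vector [2 * (t - s), 2 * (t - s)]"
      using that by (simp add: \<gamma>_def vec_eq_iff forall_2)
    then show ?thesis using that by (simp only: diagonal_scaled) simp
  qed
  have "N (\<gamma> t - \<gamma> s) \<le> c * (2 * t - 2 * s)" if "s \<le> t" for s t
  proof -
    consider "t \<le> 1 / 2" | "1 / 2 \<le> s" | "s \<le> 1 / 2" "1 / 2 \<le> t" by linarith
    then show ?thesis
    proof cases
      case 3
      then show ?thesis
        using is_norm_triangle_mid[OF norm, of "\<gamma> t" "\<gamma> s" "\<gamma> (1 / 2)"]
          up[of s "1 / 2"] down[of "1 / 2" t] by (simp add: algebra_simps)
    qed (use that up down in auto)
  qed
  then have \<gamma>: "rectifiable_path_in N lower_half_plane (vector [-1, -2]) (vector [1, -2]) \<gamma>"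
    by (intro rectifiable_path_inI[of _ "2 * c"]) (auto simp: \<gamma>_def algebra_simps)
  interpret rectifiable_weight N \<gamma> "\<lambda>t. - (\<gamma> t $ 2)"
    by (rule rectifiable_weight_height[OF \<gamma>])
  let ?I = "\<lambda>u v. LINT t:{u<..v}|arc_measure N \<gamma>. 1 / - (\<gamma> t $ 2)"
  have "?I 0 (1 / 2) \<le> c * (1 * (ln (- (\<gamma> (1 / 2) $ 2)) - ln (- (\<gamma> 0 $ 2))))"
    by (rule integral_le_ln_increment) (use c_ge_1 up in \<open>auto simp: \<gamma>_def\<close>)
  moreover have "?I (1 / 2) 1 \<le> c * (- 1 * (ln (- (\<gamma> 1 $ 2)) - ln (- (\<gamma> (1 / 2) $ 2))))"
    by (rule integral_le_ln_increment) (use c_ge_1 down in \<open>auto simp: \<gamma>_def\<close>)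
  moreover have "?I 0 1 = ?I 0 (1 / 2) + ?I (1 / 2) 1"
    by (rule integral_Ioc_split[OF continuous_on_inverse_h]) auto
  ultimately have "?I 0 1 \<le> c * (2 * (ln 3 - ln 2))"
    by (simp add: \<gamma>_def algebra_simps)
  also have "2 * (ln 3 - ln 2) = ln ((3 / 2 :: real)\<^sup>2)"
    by (simp add: ln_div ln_realpow)
  also have "(3 / 2 :: real)\<^sup>2 = 9 / 4"
    by (simp add: power2_eq_square)
  finally show ?thesis
    using qh_dist_le[OF \<gamma>] by (simp add: qh_length_eq[OF \<gamma>])
qed

text \<open>The hypothesis on \<open>c\<close> says that the bound for the tent is strictly below
  the bound for paths confined to \<open>B\<close>, whose horizontal displacement is 2.\<close>

lemma qh_ball_counterexample:
  assumes c: "c * ln (9 / 4) < 2 / 2 powr c"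
  defines "B \<equiv> qh_ball N lower_half_plane (vector [0, -1]) (c * ln 2)"
  shows "vector [-1, -2] \<in> B" and "vector [1, -2] \<in> B"
    and "\<not> (\<exists>\<gamma>. qh_geodesic N lower_half_plane (vector [-1, -2]) (vector [1, -2]) \<gamma> \<and> \<gamma> ` {0..1} \<subseteq> B)"
    and "\<not> qh_convex N lower_half_plane B"
proof -
  show a: "vector [-1, -2] \<in> B" and b: "vector [1, -2] \<in> B"
    unfolding B_def qh_ball_def using qh_dist_diagonal_le by (auto simp: lower_half_plane_def)
  have height: "- (y $ 2) \<le> 2 powr c" if "y \<in> B" for y
  proof -
    have y: "y \<in> lower_half_plane" "qh_dist N lower_half_plane (vector [0, -1]) y \<le> c * ln 2"
      using that by (auto simp: B_def qh_ball_def)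
    \<comment> \<open>The center has height 1, so its logarithm drops out.\<close>
    then have "ln (- (y $ 2)) \<le> c * ln 2"
      using ln_height_le_qh_dist[of "vector [0, -1]" y] by (simp add: lower_half_plane_def)
    then have "exp (ln (- (y $ 2))) \<le> 2 powr c"
      by (simp add: powr_def)
    then show ?thesis
      using y(1) by (simp add: lower_half_plane_def)
  qed
  show *: "\<not> (\<exists>\<gamma>. qh_geodesic N lower_half_plane (vector [-1, -2]) (vector [1, -2]) \<gamma> \<and> \<gamma> ` {0..1} \<subseteq> B)"
  proof
    assume "\<exists>\<gamma>. qh_geodesic N lower_half_plane (vector [-1, -2]) (vector [1, -2]) \<gamma> \<and> \<gamma> ` {0..1} \<subseteq> B"
    then obtain \<gamma> where \<gamma>: "rectifiable_path_in N lower_half_plane (vector [-1, -2]) (vector [1, -2]) \<gamma>"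
      and len: "qh_length N lower_half_plane \<gamma> = qh_dist N lower_half_plane (vector [-1, -2]) (vector [1, -2])"
      and B: "\<gamma> ` {0..1} \<subseteq> B"
      unfolding qh_geodesic_def by blast
    have "2 / 2 powr c \<le> qh_length N lower_half_plane \<gamma>"
      using qh_length_ge_of_height_le[OF \<gamma>, of "2 powr c"] height B by (auto simp: image_subset_iff)
    then show False
      using qh_dist_tent_le c len by linarith
  qed
  then show "\<not> qh_convex N lower_half_plane B"
    unfolding qh_convex_def using a b by blast
qed

end

subsection \<open>The norms \<open>\<ell>\<^sup>p\<close>\<close>

text \<open>For positive \<open>a\<close> and \<open>b\<close> this is convexity of the power
  function; if one of them is 0, it reduces to \<open>w powr p \<le> w\<close> for \<open>w\<close>
  between 0 and 1.\<close>

lemma powr_convex_nonneg: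
  fixes a b u v p :: real
  assumes "1 \<le> p" "0 \<le> a" "0 \<le> b" "0 \<le> u" "0 \<le> v" "u + v = 1"
  shows "(u * a + v * b) powr p \<le> u * a powr p + v * b powr p"
proof -
  have zero: "(w * d) powr p \<le> w * d powr p" if "0 \<le> w" "w \<le> 1" "0 \<le> d" for w d :: real
  proof -
    have "w powr p \<le> w powr 1"
      using that \<open>1 \<le> p\<close> by (intro powr_mono')
    then show ?thesis
      using that by (simp add: powr_mult mult_right_mono)
  qed
  consider "a = 0" | "b = 0" | "a > 0" "b > 0" using assms by linarith
  then show ?thesis
  proof cases
    case 3
    moreover have u: "u = 1 - v" using assms by simp
    ultimately show ?thesis
      using convex_onD[OF powr_convex[OF \<open>1 \<le> p\<close>], of v a b] assms(4,5) unfolding u by simp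
  qed (use zero[of v b] zero[of u a] assms in auto)
qed

lemma abs_powr_eq_power2_powr: "\<bar>a\<bar> powr p = (a\<^sup>2) powr (p / 2)" for a p :: real
proof (cases "a = 0")
  case False
  then have "a\<^sup>2 = \<bar>a\<bar> powr 2" by simp
  then show ?thesis by (simp only: powr_powr) simp
qed simp

text \<open>Writing the power as \<open>(a\<^sup>2) powr (p / 2)\<close> separates the tasks:
  squaring supplies strictness, and the exponent \<open>p / 2 \<ge> 1\<close> preserves it by
  monotonicity and convexity.\<close>

lemma abs_powr_midpoint_less:
  fixes a b p :: real
  assumes "2 \<le> p" "a \<noteq> b"
  shows "\<bar>(a + b) / 2\<bar> powr p < (\<bar>a\<bar> powr p + \<bar>b\<bar> powr p) / 2"
proof -
  have "0 < (a - b)\<^sup>2" using \<open>a \<noteq> b\<close> by simp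
  then have "((a + b) / 2)\<^sup>2 < 1 / 2 * a\<^sup>2 + 1 / 2 * b\<^sup>2"
    by (simp add: power2_eq_square field_simps)
  then have "\<bar>(a + b) / 2\<bar> powr p < (1 / 2 * a\<^sup>2 + 1 / 2 * b\<^sup>2) powr (p / 2)"
    unfolding abs_powr_eq_power2_powr using \<open>2 \<le> p\<close> by (intro powr_less_mono2) auto
  also have "\<dots> \<le> 1 / 2 * (a\<^sup>2) powr (p / 2) + 1 / 2 * (b\<^sup>2) powr (p / 2)"
    using \<open>2 \<le> p\<close> by (intro powr_convex_nonneg) auto
  finally show ?thesis by (simp add: abs_powr_eq_power2_powr)
qed

lemma lp_norm_nonneg: "0 \<le> lp_norm p x"
  by (simp add: lp_norm_def)

lemma lp_norm_powr:
  assumes "p > 0"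
  shows "lp_norm p x powr p = (\<Sum>i\<in>UNIV. \<bar>x $ i\<bar> powr p)"
  using assms by (simp add: lp_norm_def powr_powr sum_nonneg)

lemma lp_norm_less_iff:
  assumes "p > 0" "0 \<le> r"
  shows "lp_norm p x < r \<longleftrightarrow> (\<Sum>i\<in>UNIV. \<bar>x $ i\<bar> powr p) < r powr p"
proof -
  have "lp_norm p x < r \<longleftrightarrow> lp_norm p x powr p < r powr p"
  proof
    show "lp_norm p x powr p < r powr p" if "lp_norm p x < r"
      using that assms(1) by (intro powr_less_mono2 lp_norm_nonneg)
    show "lp_norm p x < r" if "lp_norm p x powr p < r powr p"
    proof (rule ccontr)
      assume "\<not> lp_norm p x < r"
      then have "r powr p \<le> lp_norm p x powr p"
        using assms by (intro powr_mono2) auto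
      with that show False by simp
    qed
  qed
  then show ?thesis
    by (simp only: lp_norm_powr[OF assms(1)])
qed

lemma lp_norm_eq_0_iff: "lp_norm p x = 0 \<longleftrightarrow> x = 0"
  by (auto simp: lp_norm_def sum_nonneg_eq_0_iff vec_eq_iff)

lemma lp_norm_scaleR:
  assumes "p > 0"
  shows "lp_norm p (r *\<^sub>R x) = \<bar>r\<bar> * lp_norm p x"
proof -
  have "(\<Sum>i\<in>UNIV. \<bar>(r *\<^sub>R x) $ i\<bar> powr p) = \<bar>r\<bar> powr p * (\<Sum>i\<in>UNIV. \<bar>x $ i\<bar> powr p)"
    by (simp add: abs_mult powr_mult sum_distrib_left)
  then show ?thesis
    using assms by (simp add: lp_norm_def powr_mult powr_powr sum_nonneg)
qed

lemma component_le_lp_norm: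
  assumes "p > 0"
  shows "\<bar>x $ i\<bar> \<le> lp_norm p x"
proof -
  have "\<bar>x $ i\<bar> powr p \<le> (\<Sum>i\<in>UNIV. \<bar>x $ i\<bar> powr p)"
    by (intro member_le_sum) auto
  then have "(\<bar>x $ i\<bar> powr p) powr (1 / p) \<le> lp_norm p x"
    unfolding lp_norm_def using assms by (intro powr_mono2) auto
  then show ?thesis
    using assms by (simp add: powr_powr)
qed

text \<open>Minkowski's inequality by normalization: convexity of the power is applied in each
  coordinate to \<open>x\<close> divided by \<open>r\<close> and \<open>y\<close> divided by
  \<open>s\<close>, with weights proportional to \<open>r\<close> and \<open>s\<close>; the bounds
  sum to 1.\<close>

lemma is_norm_lp_norm:
  assumes "1 \<le> p"
  shows "is_norm (lp_norm p)"
proof -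
  have p: "p > 0" using assms by simp
  have "lp_norm p (x + y) \<le> lp_norm p x + lp_norm p y" for x y :: "real ^ 'n"
  proof (cases "x = 0 \<or> y = 0")
    case True
    then show ?thesis using lp_norm_nonneg by auto
  next
    case False
    define r s where "r = lp_norm p x" and "s = lp_norm p y"
    have rs: "r > 0" "s > 0"
      using False lp_norm_nonneg[of p x] lp_norm_nonneg[of p y] lp_norm_eq_0_iff[of p x] lp_norm_eq_0_iff[of p y]
      by (auto simp: r_def s_def)
    have "(\<Sum>i\<in>UNIV. \<bar>(x + y) $ i\<bar> powr p / (r + s) powr p) \<le>
      (\<Sum>i\<in>UNIV. r / (r + s) * (\<bar>x $ i\<bar> powr p / r powr p) + s / (r + s) * (\<bar>y $ i\<bar> powr p / s powr p))"
    proof (rule sum_mono)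
      fix i
      have "\<bar>(x + y) $ i\<bar> powr p / (r + s) powr p = (\<bar>(x + y) $ i\<bar> / (r + s)) powr p"
        using rs by (simp add: powr_divide)
      also have "\<dots> \<le> (r / (r + s) * (\<bar>x $ i\<bar> / r) + s / (r + s) * (\<bar>y $ i\<bar> / s)) powr p"
      proof (rule powr_mono2)
        have "r / (r + s) * (\<bar>x $ i\<bar> / r) + s / (r + s) * (\<bar>y $ i\<bar> / s) = (\<bar>x $ i\<bar> + \<bar>y $ i\<bar>) / (r + s)"
          using rs by (simp add: add_divide_distrib)
        then show "\<bar>(x + y) $ i\<bar> / (r + s) \<le> r / (r + s) * (\<bar>x $ i\<bar> / r) + s / (r + s) * (\<bar>y $ i\<bar> / s)"
          using rs abs_triangle_ineq[of "x $ i" "y $ i"] by (simp add: divide_right_mono)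
      qed (use p rs in auto)
      also have "\<dots> \<le> r / (r + s) * (\<bar>x $ i\<bar> / r) powr p + s / (r + s) * (\<bar>y $ i\<bar> / s) powr p"
        using rs assms by (intro powr_convex_nonneg) (auto simp: add_divide_distrib[symmetric])
      also have "\<dots> = r / (r + s) * (\<bar>x $ i\<bar> powr p / r powr p) + s / (r + s) * (\<bar>y $ i\<bar> powr p / s powr p)"
        using rs by (simp add: powr_divide)
      finally show "\<bar>(x + y) $ i\<bar> powr p / (r + s) powr p \<le>
        r / (r + s) * (\<bar>x $ i\<bar> powr p / r powr p) + s / (r + s) * (\<bar>y $ i\<bar> powr p / s powr p)" .
    qed
    also have "\<dots> = r / (r + s) * (r powr p / r powr p) + s / (r + s) * (s powr p / s powr p)"
      unfolding sum.distrib sum_distrib_left[symmetric] sum_divide_distrib[symmetric]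
        lp_norm_powr[OF p, symmetric] r_def s_def ..
    also have "\<dots> = 1"
      using rs by (simp add: add_divide_distrib[symmetric])
    finally have "(\<Sum>i\<in>UNIV. \<bar>(x + y) $ i\<bar> powr p) \<le> (r + s) powr p"
      using rs by (simp add: sum_divide_distrib[symmetric])
    then have "\<not> r + s < lp_norm p (x + y)"
      using powr_less_mono2[OF p, of "r + s" "lp_norm p (x + y)"] rs by (auto simp: lp_norm_powr[OF p])
    then show ?thesis
      by (simp add: r_def s_def)
  qed
  then show ?thesis
    unfolding is_norm_def using p
    by (intro conjI allI) (simp_all only: lp_norm_nonneg lp_norm_eq_0_iff lp_norm_scaleR)
qed

section \<open>Uniform convexity\<close>

text \<open>In finite dimension the admissible pairs form a compact set, so the infimum is attained,
  and strict convexity makes it positive there. Without admissible pairs it is \<infinity>.\<close>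

lemma uniformly_convex_of_strictly_convex:
  fixes N :: "'a::euclidean_space \<Rightarrow> real"
  assumes norm: "is_norm N"
    and strict: "\<And>x y. N x = 1 \<Longrightarrow> N y = 1 \<Longrightarrow> x \<noteq> y \<Longrightarrow> N (x + y) < 2"
  shows "uniformly_convex N"
  unfolding uniformly_convex_def
proof (intro allI impI)
  fix \<epsilon> :: real assume \<epsilon>: "0 < \<epsilon> \<and> \<epsilon> \<le> 2"
  define K where "K = {(x, y). N x = 1 \<and> N y = 1 \<and> N (x - y) = \<epsilon>}"
  obtain m where m: "m > 0" "\<And>x. m * norm x \<le> N x"
    by (rule is_norm_ge_norm[OF norm]) blast
  have "K = {z. N (fst z) = 1} \<inter> {z. N (snd z) = 1} \<inter> {z. N (fst z - snd z) = \<epsilon>}"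
    by (auto simp: K_def)
  also have "closed \<dots>"
    by (intro closed_Int closed_Collect_eq continuous_on_is_norm_comp[OF norm] continuous_intros)
  finally have "closed K" .
  have "norm x \<le> 1 / m" if "N x = 1" for x
    using m(1) m(2)[of x] that by (simp add: field_simps)
  then have "K \<subseteq> cball 0 (1 / m) \<times> cball 0 (1 / m)"
    by (auto simp: K_def)
  then have "bounded K"
    by (rule bounded_subset[OF bounded_Times[OF bounded_cball bounded_cball]])
  with \<open>closed K\<close> have "compact K"
    by (simp add: compact_eq_bounded_closed)
  have "0 < (INF z\<in>K. ereal (1 - N (fst z + snd z) / 2))"
  proof (cases "K = {}")
    case False
    have "continuous_on K (\<lambda>z. 1 - N (fst z + snd z) / 2)"
      by (intro continuous_intros continuous_on_is_norm_comp[OF norm]) auto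
    then obtain z where z: "z \<in> K"
      "\<And>w. w \<in> K \<Longrightarrow> 1 - N (fst z + snd z) / 2 \<le> 1 - N (fst w + snd w) / 2"
      using continuous_attains_inf[OF \<open>compact K\<close> False] by blast
    have "fst z \<noteq> snd z"
      using z(1) \<epsilon> is_norm_eq_0[OF norm, of 0] by (auto simp: K_def)
    then have "0 < ereal (1 - N (fst z + snd z) / 2)"
      using strict[of "fst z" "snd z"] z(1) by (auto simp: K_def)
    also have "\<dots> \<le> (INF z\<in>K. ereal (1 - N (fst z + snd z) / 2))"
      using z(2) by (intro INF_greatest) simp
    finally show ?thesis .
  qed (simp add: top_ereal_def)
  then show "0 < (INF (x, y) \<in> {(x, y). N x = 1 \<and> N y = 1 \<and> N (x - y) = \<epsilon>}.
      ereal (1 - N (x + y) / 2))"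
    by (simp add: K_def case_prod_unfold)
qed

text \<open>Distinct vectors differ in some coordinate, where the midpoint inequality is strict;
  summing puts the midpoint strictly inside the unit ball.\<close>

lemma uniformly_convex_lp_norm:
  assumes "2 \<le> p"
  shows "uniformly_convex (lp_norm p :: real ^ 'n \<Rightarrow> real)"
proof (rule uniformly_convex_of_strictly_convex)
  have p: "p > 0" using assms by simp
  show "is_norm (lp_norm p :: real ^ 'n \<Rightarrow> real)"
    using assms by (intro is_norm_lp_norm) simp
  fix x y :: "real ^ 'n" assume xy: "lp_norm p x = 1" "lp_norm p y = 1" "x \<noteq> y"
  then obtain j where "x $ j \<noteq> y $ j" by (auto simp: vec_eq_iff)
  have "(\<Sum>i\<in>UNIV. \<bar>(x $ i + y $ i) / 2\<bar> powr p) <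
      (\<Sum>i\<in>UNIV. (\<bar>x $ i\<bar> powr p + \<bar>y $ i\<bar> powr p) / 2)"
  proof (rule sum_strict_mono_ex1)
    show "\<forall>i\<in>UNIV. \<bar>(x $ i + y $ i) / 2\<bar> powr p \<le> (\<bar>x $ i\<bar> powr p + \<bar>y $ i\<bar> powr p) / 2"
    proof
      fix i show "\<bar>(x $ i + y $ i) / 2\<bar> powr p \<le> (\<bar>x $ i\<bar> powr p + \<bar>y $ i\<bar> powr p) / 2"
        using abs_powr_midpoint_less[OF assms, of "x $ i" "y $ i"] by (cases "x $ i = y $ i") auto
    qed
    show "\<exists>i\<in>UNIV. \<bar>(x $ i + y $ i) / 2\<bar> powr p < (\<bar>x $ i\<bar> powr p + \<bar>y $ i\<bar> powr p) / 2"
      using abs_powr_midpoint_less[OF assms \<open>x $ j \<noteq> y $ j\<close>] by blast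
  qed simp
  also have "\<dots> = (lp_norm p x powr p + lp_norm p y powr p) / 2"
    by (simp only: sum_divide_distrib[symmetric] sum.distrib lp_norm_powr[OF p])
  finally have "lp_norm p ((1 / 2) *\<^sub>R (x + y)) < 1"
    using p xy by (simp add: lp_norm_less_iff)
  then show "lp_norm p (x + y) < 2"
    using p by (simp add: lp_norm_scaleR)
qed

section \<open>The two families of norms and the choice of the exponent\<close>

lemma plane_norm_lp_norm:
  assumes "1 \<le> p"
  shows "plane_norm (lp_norm p) (2 powr (1 / p))"
proof
  show "is_norm (lp_norm p :: real ^ 2 \<Rightarrow> real)"
    using assms by (rule is_norm_lp_norm)
  show "\<bar>x $ i\<bar> \<le> lp_norm p x" for x :: "real ^ 2" and i
    using assms by (intro component_le_lp_norm) simp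
qed (simp_all add: lp_norm_def UNIV_2)

lemma plane_norm_infnorm: "plane_norm infnorm 1"
proof
  show "is_norm (infnorm :: real ^ 2 \<Rightarrow> real)"
    by (simp add: is_norm_def infnorm_pos_le infnorm_eq_0 infnorm_mul infnorm_triangle)
  show "\<bar>x $ i\<bar> \<le> infnorm x" for x :: "real ^ 2" and i
    by (rule component_le_infnorm_cart)
qed (simp_all add: infnorm_2)

lemma ln_9_4_less_1: "ln (9 / 4) < (1 :: real)"
proof -
  have "ln (9 / 4 :: real) = ln ((3 / 2)\<^sup>2)"
    by (simp add: power2_eq_square)
  also have "\<dots> = 2 * ln (1 + 1 / 2)"
    by (simp add: ln_realpow)
  also have "\<dots> < 2 * (1 / 2)"
    by (intro mult_strict_left_mono ln_add_one_self_less_self) auto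
  finally show ?thesis by simp
qed

text \<open>The inequality is strict at \<open>c = 1\<close>, where it reads
  \<open>ln (9 / 4) < 1\<close>, and \<open>2 powr (1 / p)\<close> tends to 1, so continuity gives
  it for all large \<open>p\<close>. The bound \<open>p \<ge> 2\<close> serves uniform
  convexity.\<close>

lemma ex_large_p:
  fixes P :: real
  obtains p where "p > P" "p \<ge> 2" "2 powr (1 / p) * ln (9 / 4) < 2 / 2 powr (2 powr (1 / p))"
proof -
  have "((\<lambda>p::real. 1 / p) \<longlongrightarrow> 0) at_top"
    using tendsto_inverse_0_at_top[OF filterlim_ident] by (simp add: inverse_eq_divide)
  then have c: "((\<lambda>p::real. 2 powr (1 / p)) \<longlongrightarrow> 2 powr 0) at_top"
    by (intro tendsto_intros) auto
  have "((\<lambda>p::real. 2 / 2 powr (2 powr (1 / p)) - 2 powr (1 / p) * ln (9 / 4)) \<longlongrightarrow>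
      2 / 2 powr (2 powr 0) - 2 powr 0 * ln (9 / 4)) at_top"
    by (intro c tendsto_diff tendsto_divide tendsto_powr tendsto_mult tendsto_const) auto
  then have "\<forall>\<^sub>F p::real in at_top. 0 < 2 / 2 powr (2 powr (1 / p)) - 2 powr (1 / p) * ln (9 / 4)"
    by (rule order_tendstoD) (use ln_9_4_less_1 in simp)
  then have "\<forall>\<^sub>F p in at_top. p > P \<and> p \<ge> 2 \<and>
      0 < 2 / 2 powr (2 powr (1 / p)) - 2 powr (1 / p) * ln (9 / 4)"
    using eventually_gt_at_top[of P] eventually_ge_at_top[of 2] by eventually_elim simp
  then have "\<exists>p. p > P \<and> p \<ge> 2 \<and>
      0 < 2 / 2 powr (2 powr (1 / p)) - 2 powr (1 / p) * ln (9 / 4)"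
    by (rule eventually_happens'[OF trivial_limit_at_top_linorder])
  then show thesis
    using that by (elim exE conjE) simp
qed

theorem mainTheorem4:
  fixes x a b :: "real ^ 2"
  assumes "x = vector [0, -1]" and "a = vector [-1, -2]" and "b = vector [1, -2]"
  shows
    "(banach_norm (infnorm :: real ^ 2 \<Rightarrow> real) \<and>
      proper_domain infnorm lower_half_plane \<and> convex lower_half_plane \<and>
      a \<in> qh_ball infnorm lower_half_plane x (ln 2) \<and>
      b \<in> qh_ball infnorm lower_half_plane x (ln 2) \<and>
      \<not> (\<exists>\<gamma>. qh_geodesic infnorm lower_half_plane a b \<gamma> \<and>
              \<gamma> ` {0..1} \<subseteq> qh_ball infnorm lower_half_plane x (ln 2)) \<and>
      \<not> qh_convex infnorm lower_half_plane (qh_ball infnorm lower_half_plane x (ln 2)))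
     \<and>
     (\<forall>P::real. \<exists>p>P. 1 < p \<and>
        banach_norm (lp_norm p :: real ^ 2 \<Rightarrow> real) \<and>
        uniformly_convex (lp_norm p :: real ^ 2 \<Rightarrow> real) \<and>
        (\<exists>\<Omega> :: (real ^ 2) set. proper_domain (lp_norm p) \<Omega> \<and> convex \<Omega> \<and>
          (\<exists>z\<in>\<Omega>. \<exists>r>0. \<not> qh_convex (lp_norm p) \<Omega> (qh_ball (lp_norm p) \<Omega> z r))))"
proof (intro conjI allI)
  interpret plane_norm infnorm 1
    by (rule plane_norm_infnorm)
  show "banach_norm (infnorm :: real ^ 2 \<Rightarrow> real)"
    using norm by (rule banach_norm_euclidean)
  show "proper_domain infnorm lower_half_plane"
    by (rule proper_domain_lower_half_plane)
  show "convex lower_half_plane"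
    by (rule convex_lower_half_plane)
  have c: "1 * ln (9 / 4) < 2 / 2 powr (1 :: real)"
    using ln_9_4_less_1 by simp
  \<comment> \<open>With \<open>c = 1\<close> the radius \<open>c * ln 2\<close> becomes
    \<open>ln 2\<close>, and the vectors are folded back into \<open>x\<close>, \<open>a\<close> and
    \<open>b\<close>.\<close>
  note * = qh_ball_counterexample[OF c, unfolded mult_1 assms(1-3)[symmetric]]
  show "a \<in> qh_ball infnorm lower_half_plane x (ln 2)"
    "b \<in> qh_ball infnorm lower_half_plane x (ln 2)"
    "\<not> (\<exists>\<gamma>. qh_geodesic infnorm lower_half_plane a b \<gamma> \<and>
       \<gamma> ` {0..1} \<subseteq> qh_ball infnorm lower_half_plane x (ln 2))"
    "\<not> qh_convex infnorm lower_half_plane (qh_ball infnorm lower_half_plane x (ln 2))"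
    by (fact *)+
next
  fix P :: real
  obtain p where p: "p > P" "p \<ge> 2" "2 powr (1 / p) * ln (9 / 4) < 2 / 2 powr (2 powr (1 / p))"
    by (rule ex_large_p)
  interpret plane_norm "lp_norm p" "2 powr (1 / p)"
    using p by (intro plane_norm_lp_norm) simp
  let ?z = "vector [0, -1] :: real ^ 2"
  have "?z \<in> lower_half_plane" "0 < 2 powr (1 / p) * ln 2"
    by (simp_all add: lower_half_plane_def)
  moreover have "\<not> qh_convex (lp_norm p) lower_half_plane
      (qh_ball (lp_norm p) lower_half_plane ?z (2 powr (1 / p) * ln 2))"
    by (rule qh_ball_counterexample(4)[OF p(3)])
  ultimately have "\<exists>z\<in>lower_half_plane. \<exists>r>0.
      \<not> qh_convex (lp_norm p) lower_half_plane (qh_ball (lp_norm p) lower_half_plane z r)"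
    by blast
  then show "\<exists>p>P. 1 < p \<and>
        banach_norm (lp_norm p :: real ^ 2 \<Rightarrow> real) \<and>
        uniformly_convex (lp_norm p :: real ^ 2 \<Rightarrow> real) \<and>
        (\<exists>\<Omega> :: (real ^ 2) set. proper_domain (lp_norm p) \<Omega> \<and> convex \<Omega> \<and>
          (\<exists>z\<in>\<Omega>. \<exists>r>0. \<not> qh_convex (lp_norm p) \<Omega> (qh_ball (lp_norm p) \<Omega> z r)))"
    using p(1,2) by (intro exI[of _ p] conjI exI[of _ lower_half_plane] banach_norm_euclidean norm
      uniformly_convex_lp_norm proper_domain_lower_half_plane convex_lower_half_plane) simp_all
qed

end
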